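(* Let $\Omega=[0,1]^d$, let $m\ge1$, let $f\in C^{m+1}(\Omega)$ with $\min_\Omega|\nabla f|>0$, let $\Lambda$ be the uniform grid of $n$ points on $[0,1]$, let $s$ be the $m$-th degree tensor-product spline interpolant of $f$ on $\Lambda^d$, and let $N=n^d$ be the total number of sample points. Let $\boldsymbol{\alpha}$ be uniformly distributed in $\Omega$ and let $p_f$ and $p_s$ be the probability density functions of $f(\boldsymbol{\alpha})$ and $s(\boldsymbol{\alpha})$. Then for sufficiently large $N$, $$\|p_f-p_s\|_1\le K N^{-\frac{m}{d}}$$ for some constant $K>0$.
   Context: $|\cdot|$ is the Euclidean norm on $\mathbb{R}^d$ and $\|\cdot\|_1$ is the norm of $L^1(\mathbb{R})$. The constant $K$ does not depend on $N$. Tensor-product splines: let $\Lambda$ be a one-dimensional grid $0=\alpha_1<\dots<\alpha_n=1$ with $h=\max_{1\le j<n}|\alpha_{j+1}-\alpha_j|$, and $\Lambda^d$ the corresponding $d$-dimensional tensor-product grid. An $m$-th degree tensor-product spline interpolant of $f$ is a function $s\in C^{m-1}(\Omega)$ that interpolates $f$ on $\Lambda^d$ and reduces to a one-dimensional $m$-th degree spline (a $C^{m-1}$ piecewise polynomial of degree $m$ with knots in $\Lambda$) on every line of $\Lambda^d$, i.e. when $d-1$ coordinates of $\boldsymbol{\alpha}$ are fixed in $\Lambda$. It is unique when endowed with sufficiently many boundary conditions (e.g. not-a-knot); the boundary conditions are taken to be ones for which the following interpolation estimate from the literature (Schultz) holds: for any $\boldsymbol{\alpha}\in\Omega$, $$|D^j(f-s)(\boldsymbol{\alpha})|<C_m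 h^{m+1-j},\qquad j=0,1,\dots,m-1,$$ where $D^j$ is any partial derivative of total order $j$ and $C_m$ depends only on the $L^\infty$ norms of the order-$(m+1)$ derivatives of $f$.
   Formalization: The spline s is additionally required to lie in the tensor product of the one-dimensional spline spaces; smoothness, interpolation and being a spline on grid lines alone leave s free inside cells, so that for m=1, d≥2 the density p_s may fail to exist. *)

theory Defs
  imports "HOL-Probability.Probability"
begin

abbreviation unit_cube :: "'a::euclidean_space set" where
  "unit_cube \<equiv> cbox 0 One"

(* Derivatives are taken within S, hence one-sided on the boundary of a cube; there they are
   unique (frechet_derivative_unique_within_closed_interval). *)
definition partial_deriv :: "'a::euclidean_space set \<Rightarrow> 'a \<Rightarrow> ('a \<Rightarrow> real) \<Rightarrow> 'a \<Rightarrow> real" where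
  "partial_deriv S b f x = frechet_derivative f (at x within S) b"

(* The list bs of basis vectors names the partial derivative of total order length bs. *)
definition iterated_partial ::
    "'a::euclidean_space set \<Rightarrow> 'a list \<Rightarrow> ('a \<Rightarrow> real) \<Rightarrow> 'a \<Rightarrow> real" where
  "iterated_partial S bs f = foldr (partial_deriv S) bs f"

definition C_k_on :: "nat \<Rightarrow> 'a::euclidean_space set \<Rightarrow> ('a \<Rightarrow> real) \<Rightarrow> bool" where
  "C_k_on k S f \<longleftrightarrow>
     (\<forall>bs. set bs \<subseteq> Basis \<and> length bs < k \<longrightarrow> iterated_partial S bs f differentiable_on S) \<and>
     (\<forall>bs. set bs \<subseteq> Basis \<and> length bs \<le> k \<longrightarrow> continuous_on S (iterated_partial S bs f))"

definition gradient :: "'a::euclidean_space set \<Rightarrow> ('a \<Rightarrow> real) \<Rightarrow> 'a \<Rightarrow> 'a" where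
  "gradient S f x = (\<Sum>b\<in>Basis. partial_deriv S b f x *\<^sub>R b)"

(* Grids are indexed from 1: the knots of an n-point grid \<alpha> are \<alpha> 1, ..., \<alpha> n. *)
definition is_grid :: "nat \<Rightarrow> (nat \<Rightarrow> real) \<Rightarrow> bool" where
  "is_grid n \<alpha> \<longleftrightarrow> 2 \<le> n \<and> \<alpha> 1 = 0 \<and> \<alpha> n = 1 \<and> (\<forall>j\<in>{1..<n}. \<alpha> j < \<alpha> (j + 1))"

definition mesh_size :: "nat \<Rightarrow> (nat \<Rightarrow> real) \<Rightarrow> real" where
  "mesh_size n \<alpha> = Max ((\<lambda>j. \<bar>\<alpha> (j + 1) - \<alpha> j\<bar>) ` {1..<n})"

definition uniform_grid :: "nat \<Rightarrow> nat \<Rightarrow> real" where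
  "uniform_grid n j = (real j - 1) / (real n - 1)"

definition tensor_grid :: "nat \<Rightarrow> (nat \<Rightarrow> real) \<Rightarrow> 'a::euclidean_space set" where
  "tensor_grid n \<alpha> = {x. \<forall>b\<in>Basis. x \<bullet> b \<in> \<alpha> ` {1..n}}"

definition spline_1d :: "nat \<Rightarrow> nat \<Rightarrow> (nat \<Rightarrow> real) \<Rightarrow> (real \<Rightarrow> real) \<Rightarrow> bool" where
  "spline_1d m n \<alpha> \<phi> \<longleftrightarrow>
     C_k_on (m - 1) {0..1} \<phi> \<and>
     (\<forall>j\<in>{1..<n}. \<exists>p. degree p \<le> m \<and> (\<forall>t\<in>{\<alpha> j..\<alpha> (j + 1)}. \<phi> t = poly p t))"

definition tensor_product_spline ::
    "nat \<Rightarrow> nat \<Rightarrow> (nat \<Rightarrow> real) \<Rightarrow> ('a::euclidean_space \<Rightarrow> real) \<Rightarrow> bool" where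
  "tensor_product_spline m n \<alpha> s \<longleftrightarrow>
     (\<exists>(r::nat) \<phi>. (\<forall>k<r. \<forall>b\<in>Basis. spline_1d m n \<alpha> (\<phi> k b)) \<and>
        (\<forall>x\<in>unit_cube. s x = (\<Sum>k<r. \<Prod>b\<in>Basis. \<phi> k b (x \<bullet> b))))"

(* Smoothness, interpolation and the restriction to grid lines leave s largely free inside the
   grid cells; membership in the tensor product of the one-dimensional spline spaces is what
   makes s piecewise polynomial there. The third conjunct runs over the grid lines, where x
   ranges over the grid and its b-coordinate is replaced by t. *)
definition tensor_spline_interpolant ::
    "nat \<Rightarrow> nat \<Rightarrow> (nat \<Rightarrow> real) \<Rightarrow> ('a::euclidean_space \<Rightarrow> real) \<Rightarrow> ('a \<Rightarrow> real) \<Rightarrow> bool" where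
  "tensor_spline_interpolant m n \<alpha> f s \<longleftrightarrow>
     is_grid n \<alpha> \<and>
     C_k_on (m - 1) unit_cube s \<and>
     (\<forall>x\<in>tensor_grid n \<alpha>. s x = f x) \<and>
     (\<forall>x\<in>tensor_grid n \<alpha>. \<forall>b\<in>Basis. spline_1d m n \<alpha> (\<lambda>t. s (x + (t - x \<bullet> b) *\<^sub>R b))) \<and>
     tensor_product_spline m n \<alpha> s"

(* Schultz's estimate for the interpolation error, with constant C. *)
definition spline_error_estimate ::
    "nat \<Rightarrow> real \<Rightarrow> real \<Rightarrow> ('a::euclidean_space \<Rightarrow> real) \<Rightarrow> ('a \<Rightarrow> real) \<Rightarrow> bool" where
  "spline_error_estimate m C h f s \<longleftrightarrow>
     (\<forall>bs. set bs \<subseteq> Basis \<and> length bs \<le> m - 1 \<longrightarrow>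
        (\<forall>x\<in>unit_cube. \<bar>iterated_partial unit_cube bs (\<lambda>y. f y - s y) x\<bar>
           < C * h ^ (m + 1 - length bs)))"

(* Nonnegativity is not implied by the second conjunct, since ennreal truncates at 0. *)
definition is_pdf :: "'w measure \<Rightarrow> ('w \<Rightarrow> real) \<Rightarrow> (real \<Rightarrow> real) \<Rightarrow> bool" where
  "is_pdf M X p \<longleftrightarrow> (\<forall>y. 0 \<le> p y) \<and> distributed M lborel X (\<lambda>y. ennreal (p y))"

end

(* For a continuous test function \<phi> with antiderivative \<Phi> and the field V = \<nabla>f / |\<nabla>f|^2 one has
   \<phi>(f) = \<nabla>(\<Phi>(f)) \<cdot> V, hence
     \<phi>(f) - \<phi>(s) = \<nabla>(\<Phi>(f) - \<Phi>(s)) \<cdot> V + \<phi>(s) \<nabla>(s - f) \<cdot> V.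
   Integrated over the cube, the first term is moved by Gauss's formula onto V and is at most a
   constant times sup |f - s| = O(h^(m+1)), because \<Phi> is 1-Lipschitz when |\<phi>| \<le> 1; the second is
   O(sup |\<nabla>(f - s)|) = O(h^m). By duality this bounds the L^1 distance of the densities. The same
   formula with \<phi> \<ge> 0 and s alone, for which \<nabla>s \<cdot> V \<ge> 1/2 once h is small, bounds the law of
   s(\<alpha>) by a multiple of Lebesgue measure, so that the density exists. *)

theory Submission
  imports Defs
begin

section \<open>Integration by parts on the unit cube\<close>

text \<open>The obstacle is the low regularity of the spline: it is only C^(m-1), hence for m = 1
  merely continuous, and \<Phi>(s) cannot be differentiated everywhere. The tensor-product form
  compensates for this. On each open grid cell s is a polynomial, the knot hyperplanes between the
  cells form a null set, and across them s is still Lipschitz. The argument therefore works with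
  Lipschitz functions that have partial derivatives off a null set, and Gauss's formula is proved as
  an inequality for such functions: its bound contains the supremum of the differentiated function
  but not its Lipschitz constant, which is what makes sup |f - s| appear. The field V is Lipschitz
  because f is at least C^2 and |\<nabla>f| is bounded below. V and its constants are fixed by f
  before any grid is chosen, so K does not depend on N. The duality uses continuous test functions
  with values in [0,1] only. Tents and inner regularity carry their bounds over to Borel sets, and
  the set where one density exceeds the other yields the L^1 norm.\<close>

lemma unit_cube_slab_le:
  assumes "b \<in> Basis" "0 \<le> c" "c \<le> 1"
  shows "unit_cube \<inter> {x. x \<bullet> b \<le> c} = cbox 0 (One - (1 - c) *\<^sub>R b)"
proof (intro set_eqI)
  fix x
  show "x \<in> unit_cube \<inter> {x. x \<bullet> b \<le> c} \<longleftrightarrow> x \<in> cbox 0 (One - (1 - c) *\<^sub>R b)"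
    using assms
    apply (simp add: mem_box inner_diff_left inner_Basis)
    by (smt (verit, best) mult_cancel_left1 mult_zero_right)
qed

lemma unit_cube_slab_ge:
  assumes "b \<in> Basis" "0 \<le> c" "c \<le> 1"
  shows "unit_cube \<inter> {x. c \<le> x \<bullet> b} = cbox (c *\<^sub>R b) One"
proof (intro set_eqI)
  fix x
  show "x \<in> unit_cube \<inter> {x. c \<le> x \<bullet> b} \<longleftrightarrow> x \<in> cbox (c *\<^sub>R b) One"
    using assms
    apply (simp add: mem_box inner_Basis)
    by (smt (verit, best) mult_cancel_left1 mult_zero_right)
qed

lemma content_slab_le:
  assumes "b \<in> Basis" "0 \<le> c" "c \<le> 1"
  shows "measure lborel (cbox 0 (One - (1 - c) *\<^sub>R b)) = c"
proof -
  have "measure lborel (cbox 0 (One - (1 - c) *\<^sub>R b)) = (\<Prod>i\<in>Basis. 1 - (1 - c) * (if b = i then 1 else 0))"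
    using assms by (subst content_cbox) (auto simp: inner_diff_left inner_Basis)
  also have "\<dots> = (\<Prod>i\<in>Basis. if i = b then c else 1)"
    by (rule prod.cong) auto
  finally show ?thesis using assms by simp
qed

lemma content_slab_ge:
  assumes "b \<in> Basis" "0 \<le> c" "c \<le> 1"
  shows "measure lborel (cbox (c *\<^sub>R b) One) = 1 - c"
proof -
  have "measure lborel (cbox (c *\<^sub>R b) One) = (\<Prod>i\<in>Basis. 1 - c * (if b = i then 1 else 0))"
    using assms by (subst content_cbox) (auto simp: inner_diff_left inner_Basis)
  also have "\<dots> = (\<Prod>i\<in>Basis. if i = b then 1 - c else 1)"
    by (rule prod.cong) auto
  finally show ?thesis using assms by simp
qed

lemma integral_bound_real:
  fixes f :: "'a::euclidean_space \<Rightarrow> real"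
  assumes "0 \<le> K" "continuous_on (cbox u v) f" "\<And>x. x \<in> cbox u v \<Longrightarrow> \<bar>f x\<bar> \<le> K"
  shows "\<bar>integral (cbox u v) f\<bar> \<le> K * measure lborel (cbox u v)"
  using has_integral_bound[OF assms(1) integrable_integral[OF integrable_continuous[OF assms(2)]]]
    assms(3) by auto

lemma has_integral_diff_negligible:
  fixes f :: "'a::euclidean_space \<Rightarrow> 'b::banach"
  assumes "negligible N"
  shows "(f has_integral y) (S - N) \<longleftrightarrow> (f has_integral y) S"
  by (rule has_integral_spike_set_eq) (use assms in \<open>auto intro: negligible_subset\<close>)

text \<open>Summation by parts: the substitution x - e b moves the increment from
  \<open>\<Psi>\<close> to \<open>w\<close>, where it is at most L e. What is left over are two
  boundary slabs of thickness e, each contributing at most A B e. After division by e the bound no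
  longer depends on e.\<close>

lemma difference_quotient_bound:
  fixes \<Psi> w :: "'a::euclidean_space \<Rightarrow> real"
  assumes b: "b \<in> Basis" and e: "0 < e" "e \<le> 1"
    and cont: "continuous_on unit_cube \<Psi>" "continuous_on unit_cube w"
    and A: "\<And>x. x \<in> unit_cube \<Longrightarrow> \<bar>\<Psi> x\<bar> \<le> A"
    and B: "\<And>x. x \<in> unit_cube \<Longrightarrow> \<bar>w x\<bar> \<le> B"
    and L: "L-lipschitz_on unit_cube w"
  shows "\<bar>integral (cbox 0 (One - e *\<^sub>R b)) (\<lambda>x. (\<Psi> (x + e *\<^sub>R b) - \<Psi> x) * w x)\<bar>
    \<le> e * (A * (L + 2 * B))"
proof -
  let ?lo = "cbox 0 (One - e *\<^sub>R b)" and ?hi = "cbox (e *\<^sub>R b) One"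
  have lo: "?lo = unit_cube \<inter> {x. x \<bullet> b \<le> 1 - e}" and hi: "?hi = unit_cube \<inter> {x. e \<le> x \<bullet> b}"
    using unit_cube_slab_le[OF b, of "1 - e"] unit_cube_slab_ge[OF b, of e] e by auto
  have lo_sub: "?lo \<subseteq> unit_cube" and hi_sub: "?hi \<subseteq> unit_cube"
    using lo hi by auto
  have shift_hi: "x - e *\<^sub>R b \<in> unit_cube" if "x \<in> ?hi" for x
    using that b e by (auto simp: mem_box inner_diff_left inner_Basis split: if_splits)
  have shift_lo: "x + e *\<^sub>R b \<in> unit_cube" if "x \<in> ?lo" for x
    using that b e by (auto simp: mem_box inner_diff_left inner_add_left inner_Basis split: if_splits)
  have A0: "0 \<le> A" and B0: "0 \<le> B"
    using A[of 0] B[of 0] by (force simp: mem_box)+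
  have L0: "0 \<le> L" using L by (rule lipschitz_on_nonneg)
  have c1: "continuous_on ?hi (\<lambda>x. \<Psi> x * w (x - e *\<^sub>R b))"
    using shift_hi hi_sub
    by (auto intro!: continuous_intros continuous_on_compose2[OF cont(2)] continuous_on_subset[OF cont(1)])
  have c2: "continuous_on ?lo (\<lambda>x. \<Psi> (x + e *\<^sub>R b) * w x)"
    using shift_lo lo_sub
    by (auto intro!: continuous_intros continuous_on_compose2[OF cont(1)] continuous_on_subset[OF cont(2)])
  have c3: "continuous_on unit_cube (\<lambda>x. \<Psi> x * w x)"
    by (intro continuous_intros cont)
  note c3lo = continuous_on_subset[OF c3 lo_sub] and c3hi = continuous_on_subset[OF c3 hi_sub]
  have "integral ?lo (\<lambda>x. \<Psi> (x + e *\<^sub>R b) * w x) = integral ?hi (\<lambda>x. \<Psi> x * w (x - e *\<^sub>R b))"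
    using has_integral_affinity'[OF integrable_integral[OF integrable_continuous[OF c1]], of 1 "e *\<^sub>R b"]
    by (simp add: integral_unique)
  moreover have "integral ?hi (\<lambda>x. \<Psi> x * w (x - e *\<^sub>R b)) =
      integral ?hi (\<lambda>x. \<Psi> x * (w (x - e *\<^sub>R b) - w x)) + integral ?hi (\<lambda>x. \<Psi> x * w x)"
    using c1 c3hi
    by (simp add: algebra_simps Henstock_Kurzweil_Integration.integral_diff integrable_continuous)
  moreover have "integral ?lo (\<lambda>x. (\<Psi> (x + e *\<^sub>R b) - \<Psi> x) * w x) =
      integral ?lo (\<lambda>x. \<Psi> (x + e *\<^sub>R b) * w x) - integral ?lo (\<lambda>x. \<Psi> x * w x)"
    using c2 c3lo
    by (simp add: algebra_simps Henstock_Kurzweil_Integration.integral_diff integrable_continuous)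
  moreover
  \<comment> \<open>Up to a face, \<open>?bot\<close> and \<open>?top\<close> are the complements of
    \<open>?hi\<close> and \<open>?lo\<close> in the cube. Both integrals of
    \<open>\<Psi> x * w x\<close> are compared with the one over the whole cube, so only the thin
    slabs survive in the difference.\<close>
  let ?bot = "cbox 0 (One - (1 - e) *\<^sub>R b)" and ?top = "cbox ((1 - e) *\<^sub>R b) One"
  have bot: "?bot = unit_cube \<inter> {x. x \<bullet> b \<le> e}" and top: "?top = unit_cube \<inter> {x. 1 - e \<le> x \<bullet> b}"
    using unit_cube_slab_le[OF b, of e] unit_cube_slab_ge[OF b, of "1 - e"] e by auto
  have "integral unit_cube (\<lambda>x. \<Psi> x * w x) =
      integral ?bot (\<lambda>x. \<Psi> x * w x) + integral ?hi (\<lambda>x. \<Psi> x * w x)"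
    using integral_split[OF integrable_continuous[OF c3] b, of e] by (simp only: bot hi)
  moreover have "integral unit_cube (\<lambda>x. \<Psi> x * w x) =
      integral ?lo (\<lambda>x. \<Psi> x * w x) + integral ?top (\<lambda>x. \<Psi> x * w x)"
    using integral_split[OF integrable_continuous[OF c3] b, of "1 - e"] by (simp only: lo top)
  moreover have "\<bar>integral ?bot (\<lambda>x. \<Psi> x * w x)\<bar> \<le> A * B * measure lborel ?bot"
    using A B A0 B0 bot
    by (intro integral_bound_real continuous_on_subset[OF c3]) (auto simp: abs_mult intro!: mult_mono)
  then have "\<bar>integral ?bot (\<lambda>x. \<Psi> x * w x)\<bar> \<le> A * B * e"
    using content_slab_le[OF b, of e] e by simp
  moreover have "\<bar>integral ?top (\<lambda>x. \<Psi> x * w x)\<bar> \<le> A * B * measure lborel ?top"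
    using A B A0 B0 top
    by (intro integral_bound_real continuous_on_subset[OF c3]) (auto simp: abs_mult intro!: mult_mono)
  then have "\<bar>integral ?top (\<lambda>x. \<Psi> x * w x)\<bar> \<le> A * B * e"
    using content_slab_ge[OF b, of "1 - e"] e by simp
  moreover have "\<bar>integral ?hi (\<lambda>x. \<Psi> x * (w (x - e *\<^sub>R b) - w x))\<bar> \<le> A * (L * e) * measure lborel ?hi"
  proof (rule integral_bound_real)
    show "continuous_on ?hi (\<lambda>x. \<Psi> x * (w (x - e *\<^sub>R b) - w x))"
      using continuous_on_diff[OF c1 c3hi] by (simp add: algebra_simps)
    fix x assume x: "x \<in> ?hi"
    have "\<bar>w (x - e *\<^sub>R b) - w x\<bar> \<le> L * e"
      using lipschitz_onD[OF L shift_hi[OF x], of x] x hi_sub b e by (auto simp: dist_norm)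
    then show "\<bar>\<Psi> x * (w (x - e *\<^sub>R b) - w x)\<bar> \<le> A * (L * e)"
      using A[of x] x hi_sub A0 by (auto simp: abs_mult intro!: mult_mono)
  qed (use A0 L0 e in auto)
  then have "\<bar>integral ?hi (\<lambda>x. \<Psi> x * (w (x - e *\<^sub>R b) - w x))\<bar> \<le> A * (L * e)"
    using content_slab_ge[OF b, of e] e A0 L0
    by (smt (verit) mult_left_le mult_nonneg_nonneg)
  ultimately show ?thesis by (simp add: algebra_simps)
qed

text \<open>The boundary and volume terms of Gauss's formula are bounded by translation invariance of the
  integral, which avoids iterated integrals.\<close>

lemma integration_by_parts_bound:
  fixes \<Psi> w D :: "'a::euclidean_space \<Rightarrow> real"
  assumes b: "b \<in> Basis"
    and w: "continuous_on unit_cube w"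
    and A: "\<And>x. x \<in> unit_cube \<Longrightarrow> \<bar>\<Psi> x\<bar> \<le> A"
    and B: "\<And>x. x \<in> unit_cube \<Longrightarrow> \<bar>w x\<bar> \<le> B"
    and L: "L-lipschitz_on unit_cube w"
    and lip: "H-lipschitz_on unit_cube \<Psi>"
    and N: "negligible N"
    and interior: "\<And>x. x \<in> unit_cube - N \<Longrightarrow> x \<bullet> b < 1"
    and D: "\<And>x. x \<in> unit_cube - N \<Longrightarrow> ((\<lambda>t. \<Psi> (x + t *\<^sub>R b)) has_real_derivative D x) (at 0)"
  shows "(\<lambda>x. D x * w x) integrable_on (unit_cube - N)"
    and "\<bar>integral (unit_cube - N) (\<lambda>x. D x * w x)\<bar> \<le> A * (L + 2 * B)"
proof -
  have cont: "continuous_on unit_cube \<Psi>" using lip by (rule lipschitz_on_continuous_on)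
  define e where "e k = inverse (real (Suc k))" for k
  have e: "0 < e k" "e k \<le> 1" for k by (auto simp: e_def field_simps)
  have e0: "e \<longlonglongrightarrow> 0" unfolding e_def by (rule LIMSEQ_inverse_real_of_nat)
  let ?lo = "\<lambda>k. cbox 0 (One - e k *\<^sub>R b)"
  have lo: "?lo k = unit_cube \<inter> {x. x \<bullet> b \<le> 1 - e k}" for k
    using unit_cube_slab_le[OF b, of "1 - e k"] e[of k] by auto
  have shift: "x + e k *\<^sub>R b \<in> unit_cube" if "x \<in> ?lo k" for x k
    using that b e[of k] by (auto simp: mem_box inner_diff_left inner_add_left inner_Basis split: if_splits)
  define F where "F k x = (\<Psi> (x + e k *\<^sub>R b) - \<Psi> x) * w x" for k x
  \<comment> \<open>Extended by zero to the slab from which the shift leaves the cube, so that all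
    difference quotients share one domain, as dominated convergence requires.\<close>
  define G where "G k x = (if x \<in> ?lo k then F k x / e k else 0)" for k x
  have contF: "continuous_on (?lo k) (F k)" for k
    unfolding F_def using shift lo
    by (auto intro!: continuous_intros continuous_on_compose2[OF cont] continuous_on_subset[OF cont]
        continuous_on_subset[OF w])
  have Fint: "(F k has_integral integral (?lo k) (F k)) (?lo k)" for k
    using contF by (intro integrable_integral integrable_continuous)
  have "(G k has_integral (integral (?lo k) (F k) / e k)) unit_cube" for k
    unfolding G_def using has_integral_divide[OF Fint[of k], of "e k"] lo[of k]
    by (subst has_integral_restrict) auto
  then have Gint: "(G k has_integral (integral (?lo k) (F k) / e k)) (unit_cube - N)" for k
    by (simp add: has_integral_diff_negligible N)
  \<comment> \<open>The Lipschitz constant \<open>H\<close> enters only the dominating function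
    \<open>H * B\<close>; the final bound is the one of the difference quotients.\<close>
  have H0: "0 \<le> H" using lip by (rule lipschitz_on_nonneg)
  have B0: "0 \<le> B" using B[of 0] by (force simp: mem_box)
  have Gle: "norm (G k x) \<le> H * B" if "x \<in> unit_cube - N" for k x
  proof (cases "x \<in> ?lo k")
    case True
    have "\<bar>\<Psi> (x + e k *\<^sub>R b) - \<Psi> x\<bar> \<le> H * e k"
      using lipschitz_onD[OF lip shift[OF True], of x] that b e[of k] by (auto simp: dist_norm)
    then have "\<bar>F k x\<bar> \<le> (H * e k) * B"
      unfolding F_def abs_mult using B[of x] that H0 e[of k] by (intro mult_mono) auto
    then show ?thesis using e[of k] True by (simp add: G_def field_simps)
  qed (use H0 B0 in \<open>auto simp: G_def\<close>)
  \<comment> \<open>As x lies strictly below the upper face, it belongs to \<open>?lo k\<close> for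
    all large k, where \<open>G k x\<close> is the true difference quotient times
    \<open>w x\<close>.\<close>
  have lim: "(\<lambda>k. G k x) \<longlonglongrightarrow> D x * w x" if x: "x \<in> unit_cube - N" for x
  proof -
    have "\<forall>\<^sub>F k in sequentially. e k < 1 - x \<bullet> b"
      using order_tendstoD(2)[OF e0] interior[OF x] by simp
    then have ev: "\<forall>\<^sub>F k in sequentially. (\<Psi> (x + e k *\<^sub>R b) - \<Psi> x) / e k * w x = G k x"
      by eventually_elim (use x lo in \<open>auto simp: G_def F_def\<close>)
    have "filterlim e (at 0) sequentially"
      using e0 e by (auto simp: filterlim_at intro!: always_eventually) (metis less_irrefl)
    then have "(\<lambda>k. (\<Psi> (x + e k *\<^sub>R b) - \<Psi> x) / e k) \<longlonglongrightarrow> D x"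
      using filterlim_compose[OF D[OF x, unfolded has_field_derivative_iff]] by auto
    then have "(\<lambda>k. (\<Psi> (x + e k *\<^sub>R b) - \<Psi> x) / e k * w x) \<longlonglongrightarrow> D x * w x"
      by (intro tendsto_intros)
    then show ?thesis using ev by (rule Lim_transform_eventually)
  qed
  have const: "(\<lambda>x::'a. H * B) integrable_on unit_cube - N"
    using integrable_const[of "H * B" "0::'a" One]
    by (simp add: integrable_on_def has_integral_diff_negligible N)
  note dct = dominated_convergence[OF has_integral_integrable[OF Gint] const Gle lim]
  show "(\<lambda>x. D x * w x) integrable_on (unit_cube - N)" by (rule dct(1))
  have "\<bar>integral (unit_cube - N) (G k)\<bar> \<le> A * (L + 2 * B)" for k
    using difference_quotient_bound[OF b e[of k] cont w A B L] e[of k]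
    by (simp add: integral_unique[OF Gint] F_def[abs_def] pos_divide_le_eq mult.commute)
  moreover have "(\<lambda>k. \<bar>integral (unit_cube - N) (G k)\<bar>) \<longlonglongrightarrow> \<bar>integral (unit_cube - N) (\<lambda>x. D x * w x)\<bar>"
    using dct(2) by (rule tendsto_rabs)
  ultimately show "\<bar>integral (unit_cube - N) (\<lambda>x. D x * w x)\<bar> \<le> A * (L + 2 * B)"
    by (intro LIMSEQ_le_const2) auto
qed

section \<open>Antiderivatives of test functions, and Lipschitz vector fields on the cube\<close>

lemma lipschitz_on_antiderivative:
  fixes \<Phi> \<phi> :: "real \<Rightarrow> real"
  assumes \<Phi>: "\<And>y. y \<in> {a<..<c} \<Longrightarrow> (\<Phi> has_real_derivative \<phi> y) (at y)"
    and \<phi>: "\<And>y. \<bar>\<phi> y\<bar> \<le> 1"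
  shows "1-lipschitz_on {a<..<c} \<Phi>"
proof (rule lipschitz_onI)
  fix x y assume "x \<in> {a<..<c}" "y \<in> {a<..<c}"
  then show "dist (\<Phi> x) (\<Phi> y) \<le> 1 * dist x y"
    using field_differentiable_bound[of "{a<..<c}" \<Phi> \<phi> 1 x y] \<Phi> \<phi>
    by (auto simp: dist_norm intro: has_field_derivative_at_within)
qed simp

lemma lipschitz_on_compose_antiderivative:
  fixes \<Phi> \<phi> :: "real \<Rightarrow> real" and u :: "'a::metric_space \<Rightarrow> real"
  assumes u: "H-lipschitz_on S u" "u ` S \<subseteq> {a<..<c}"
    and \<Phi>: "\<And>y. y \<in> {a<..<c} \<Longrightarrow> (\<Phi> has_real_derivative \<phi> y) (at y)"
    and \<phi>: "\<And>y. \<bar>\<phi> y\<bar> \<le> 1"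
  shows "H-lipschitz_on S (\<lambda>x. \<Phi> (u x))"
  using lipschitz_on_compose2[OF u(1) lipschitz_on_subset[OF lipschitz_on_antiderivative[OF \<Phi> \<phi>] u(2)]]
  by simp

text \<open>In the application \<open>w b\<close> are the components of \<open>\<nabla>f / \<bar>\<nabla>f\<bar>\<^sup>2\<close>.\<close>

locale cube_vector_field =
  fixes N :: "'a::euclidean_space set" and w :: "'a \<Rightarrow> 'a \<Rightarrow> real" and L B :: real
  assumes negligible_N: "negligible N"
    and interior: "\<And>x b. x \<in> unit_cube - N \<Longrightarrow> b \<in> Basis \<Longrightarrow> x \<bullet> b < 1"
    and lipschitz_w: "\<And>b. b \<in> Basis \<Longrightarrow> L-lipschitz_on unit_cube (w b)"
    and bound_w: "\<And>x b. x \<in> unit_cube \<Longrightarrow> b \<in> Basis \<Longrightarrow> \<bar>w b x\<bar> \<le> B"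
begin

lemma B_nonneg: "0 \<le> B"
  using bound_w[of 0 "SOME b. b \<in> Basis"] by (force simp: mem_box SOME_Basis)

lemma L_nonneg: "0 \<le> L"
  using lipschitz_w[of "SOME b. b \<in> Basis"] by (simp add: SOME_Basis lipschitz_on_nonneg)

text \<open>The one-direction bounds are summed over the coordinates: \<open>L\<close> stands for
  one diagonal term of the divergence of the field, \<open>2 * B\<close> for the flux through two
  opposite faces.\<close>

lemma divergence_bound:
  assumes A: "\<And>x. x \<in> unit_cube \<Longrightarrow> \<bar>\<Psi> x\<bar> \<le> A"
    and lip: "H-lipschitz_on unit_cube \<Psi>"
    and D: "\<And>x b. x \<in> unit_cube - N \<Longrightarrow> b \<in> Basis \<Longrightarrow>
      ((\<lambda>t. \<Psi> (x + t *\<^sub>R b)) has_real_derivative D b x) (at 0)"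
  shows "(\<lambda>x. \<Sum>b\<in>Basis. D b x * w b x) integrable_on (unit_cube - N)"
    and "\<bar>integral (unit_cube - N) (\<lambda>x. \<Sum>b\<in>Basis. D b x * w b x)\<bar> \<le> DIM('a) * (A * (L + 2 * B))"
proof -
  have *: "(\<lambda>x. D b x * w b x) integrable_on (unit_cube - N)"
    "\<bar>integral (unit_cube - N) (\<lambda>x. D b x * w b x)\<bar> \<le> A * (L + 2 * B)" if b: "b \<in> Basis" for b
    using integration_by_parts_bound[OF b lipschitz_on_continuous_on[OF lipschitz_w[OF b]]
        A bound_w[OF _ b] lipschitz_w[OF b] lip negligible_N interior[OF _ b] D[OF _ b]]
    by auto
  show "(\<lambda>x. \<Sum>b\<in>Basis. D b x * w b x) integrable_on (unit_cube - N)"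
    using * by (intro integrable_sum) auto
  have "\<bar>integral (unit_cube - N) (\<lambda>x. \<Sum>b\<in>Basis. D b x * w b x)\<bar>
      = \<bar>\<Sum>b\<in>Basis. integral (unit_cube - N) (\<lambda>x. D b x * w b x)\<bar>"
    using * by (subst Henstock_Kurzweil_Integration.integral_sum) auto
  also have "\<dots> \<le> (\<Sum>b\<in>(Basis::'a set). A * (L + 2 * B))"
    using * by (intro order_trans[OF sum_abs] sum_mono) auto
  finally show "\<bar>integral (unit_cube - N) (\<lambda>x. \<Sum>b\<in>Basis. D b x * w b x)\<bar> \<le> DIM('a) * (A * (L + 2 * B))"
    by simp
qed

lemma integral_diff_N:
  "integral (unit_cube - N) h = integral unit_cube h" for h :: "'a \<Rightarrow> real"
  by (metis has_integral_diff_negligible[OF negligible_N] eq_integralD integral_unique)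

lemma integrable_diff_N:
  "h integrable_on (unit_cube - N) \<longleftrightarrow> h integrable_on unit_cube" for h :: "'a \<Rightarrow> real"
  by (simp add: integrable_on_def has_integral_diff_negligible[OF negligible_N])

text \<open>The two error terms enter separately: \<open>\<eta>\<close> as the supremum of
  \<open>\<Phi> (f x) - \<Phi> (s x)\<close>, \<open>\<Phi>\<close> being 1-Lipschitz, and
  \<open>\<delta>\<close> through the remainder \<open>R\<close>. The open interval contains both
  ranges, so that \<open>\<Phi>\<close> is differentiable wherever it is evaluated.\<close>

lemma integral_test_function_diff:
  assumes f: "Hf-lipschitz_on unit_cube f" "f ` unit_cube \<subseteq> {a<..<c}"
    and s: "Hs-lipschitz_on unit_cube s" "s ` unit_cube \<subseteq> {a<..<c}"
    and df: "\<And>x b. x \<in> unit_cube - N \<Longrightarrow> b \<in> Basis \<Longrightarrow>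
      ((\<lambda>t. f (x + t *\<^sub>R b)) has_real_derivative g b x) (at 0)"
    and ds: "\<And>x b. x \<in> unit_cube - N \<Longrightarrow> b \<in> Basis \<Longrightarrow>
      ((\<lambda>t. s (x + t *\<^sub>R b)) has_real_derivative e b x) (at 0)"
    and unit: "\<And>x. x \<in> unit_cube \<Longrightarrow> (\<Sum>b\<in>Basis. g b x * w b x) = 1"
    and \<delta>: "\<And>x b. x \<in> unit_cube - N \<Longrightarrow> b \<in> Basis \<Longrightarrow> \<bar>e b x - g b x\<bar> \<le> \<delta>"
    and \<eta>: "\<And>x. x \<in> unit_cube \<Longrightarrow> \<bar>f x - s x\<bar> \<le> \<eta>"
    and \<Phi>: "\<And>y. y \<in> {a<..<c} \<Longrightarrow> (\<Phi> has_real_derivative \<phi> y) (at y)"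
    and \<phi>: "continuous_on UNIV \<phi>" "\<And>y. \<bar>\<phi> y\<bar> \<le> 1"
  shows "\<bar>integral unit_cube (\<lambda>x. \<phi> (f x)) - integral unit_cube (\<lambda>x. \<phi> (s x))\<bar>
    \<le> DIM('a) * (\<eta> * (L + 2 * B) + \<delta> * B)"
proof -
  define D where "D b x = \<phi> (f x) * g b x - \<phi> (s x) * e b x" for b x
  have b0: "(SOME b::'a. b \<in> Basis) \<in> Basis" by (rule SOME_Basis)
  have lipf: "Hf-lipschitz_on unit_cube (\<lambda>x. \<Phi> (f x))" and lips: "Hs-lipschitz_on unit_cube (\<lambda>x. \<Phi> (s x))"
    using lipschitz_on_compose_antiderivative[OF f \<Phi> \<phi>(2)]
      lipschitz_on_compose_antiderivative[OF s \<Phi> \<phi>(2)] by auto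
  have lip1: "1-lipschitz_on {a<..<c} \<Phi>"
    using lipschitz_on_antiderivative[OF \<Phi> \<phi>(2)] .
  have A: "\<bar>\<Phi> (f x) - \<Phi> (s x)\<bar> \<le> \<eta>" if "x \<in> unit_cube" for x
  proof -
    have "f x \<in> {a<..<c}" "s x \<in> {a<..<c}" using that f(2) s(2) by auto
    then show ?thesis
      using lipschitz_onD[OF lip1, of "f x" "s x"] \<eta>[OF that] by (simp add: dist_norm)
  qed
  have D: "((\<lambda>t. \<Phi> (f (x + t *\<^sub>R b)) - \<Phi> (s (x + t *\<^sub>R b))) has_real_derivative D b x) (at 0)"
    if x: "x \<in> unit_cube - N" and b: "b \<in> Basis" for x b
  proof -
    have "f x \<in> {a<..<c}" "s x \<in> {a<..<c}" using x f(2) s(2) by auto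
    then show ?thesis
      unfolding D_def using DERIV_chain2[OF _ df[OF x b], of \<Phi> "\<phi> (f x)"]
        DERIV_chain2[OF _ ds[OF x b], of \<Phi> "\<phi> (s x)"] \<Phi>
      by (intro DERIV_diff) auto
  qed
  note div = divergence_bound[OF A lipschitz_on_diff[OF lipf lips] D]
  \<comment> \<open>Writing e = g + (e - g) and using that g pairs with w to 1 splits the pairing of
    e with w into 1 and the error; \<open>R\<close> is this error weighted by
    \<open>\<phi> (s x)\<close>.\<close>
  define R where "R x = \<phi> (s x) * (\<Sum>b\<in>Basis. (e b x - g b x) * w b x)" for x
  have sumD: "(\<Sum>b\<in>Basis. D b x * w b x) = \<phi> (f x) - \<phi> (s x) - R x" if "x \<in> unit_cube" for x
  proof -
    have "(\<Sum>b\<in>Basis. D b x * w b x)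
      = \<phi> (f x) * (\<Sum>b\<in>Basis. g b x * w b x) - \<phi> (s x) * (\<Sum>b\<in>Basis. e b x * w b x)"
      by (simp add: D_def sum_subtractf sum_distrib_left algebra_simps)
    also have "\<dots> = \<phi> (f x) - \<phi> (s x) - R x"
      using unit[OF that] by (simp add: R_def sum_subtractf algebra_simps)
    finally show ?thesis .
  qed
  have intf: "(\<lambda>x. \<phi> (f x)) integrable_on (unit_cube - N)"
    and ints: "(\<lambda>x. \<phi> (s x)) integrable_on (unit_cube - N)"
    unfolding integrable_diff_N
    by (intro integrable_continuous continuous_on_compose2[OF \<phi>(1)]
        lipschitz_on_continuous_on[OF f(1)] lipschitz_on_continuous_on[OF s(1)]; simp)+
  \<comment> \<open>No measurability of \<open>e b\<close> is available. Integrability of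
    \<open>R\<close> is read off from the other terms of the identity, of which the sum over
    \<open>D\<close> is integrable as a limit under dominated convergence.\<close>
  have intR: "R integrable_on (unit_cube - N)"
  proof (rule integrable_eq)
    show "(\<lambda>x. \<phi> (f x) - \<phi> (s x) - (\<Sum>b\<in>Basis. D b x * w b x)) integrable_on (unit_cube - N)"
      by (intro integrable_diff intf ints div(1))
  qed (simp add: sumD)
  have \<delta>0: "0 \<le> \<delta>" if "x \<in> unit_cube - N" for x
    using \<delta>[OF that b0] by simp
  have Rle: "norm (R x) \<le> DIM('a) * (\<delta> * B)" if x: "x \<in> unit_cube - N" for x
  proof -
    have "\<bar>\<Sum>b\<in>Basis. (e b x - g b x) * w b x\<bar> \<le> (\<Sum>b\<in>(Basis::'a set). \<delta> * B)"
      using \<delta>[OF x] bound_w[of x] x \<delta>0[OF x]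
      by (intro order_trans[OF sum_abs] sum_mono) (auto simp: abs_mult intro!: mult_mono)
    then have "1 * \<bar>\<Sum>b\<in>Basis. (e b x - g b x) * w b x\<bar> \<le> DIM('a) * (\<delta> * B)" by simp
    then show ?thesis
      unfolding R_def real_norm_def abs_mult
      by (rule order_trans[rotated]) (intro mult_right_mono \<phi>(2), simp)
  qed
  have intc: "(\<lambda>x::'a. DIM('a) * (\<delta> * B)) integrable_on (unit_cube - N)"
    unfolding integrable_diff_N by (rule integrable_const)
  have "\<bar>integral (unit_cube - N) R\<bar> \<le> integral (unit_cube - N) (\<lambda>x. DIM('a) * (\<delta> * B))"
    using integral_norm_bound_integral[OF intR intc Rle] by simp
  also have "\<dots> = DIM('a) * (\<delta> * B)"
    unfolding integral_diff_N by (simp add: content_cbox)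
  finally have Rbound: "\<bar>integral (unit_cube - N) R\<bar> \<le> DIM('a) * (\<delta> * B)" .
  have "integral (unit_cube - N) (\<lambda>x. \<Sum>b\<in>Basis. D b x * w b x)
      = integral (unit_cube - N) (\<lambda>x. \<phi> (f x) - \<phi> (s x) - R x)"
    by (rule integral_cong) (simp add: sumD)
  also have "\<dots> = integral (unit_cube - N) (\<lambda>x. \<phi> (f x)) - integral (unit_cube - N) (\<lambda>x. \<phi> (s x))
      - integral (unit_cube - N) R"
    using intf ints intR by (simp add: Henstock_Kurzweil_Integration.integral_diff integrable_diff)
  finally show ?thesis
    using div(2) Rbound by (simp add: integral_diff_N algebra_simps)
qed

text \<open>By transversality \<open>\<phi> (s x) / 2\<close> is at most the derivative of
  \<open>\<Phi> (s x)\<close> along the field. The bound is linear in \<open>I\<close>; with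
  \<open>I\<close> the integral of \<open>\<phi>\<close> over an interval around the range of s, it
  compares the law of s with Lebesgue measure.\<close>

lemma integral_test_function_bound:
  assumes s: "Hs-lipschitz_on unit_cube s" "s ` unit_cube \<subseteq> {a<..<c}"
    and ds: "\<And>x b. x \<in> unit_cube - N \<Longrightarrow> b \<in> Basis \<Longrightarrow>
      ((\<lambda>t. s (x + t *\<^sub>R b)) has_real_derivative e b x) (at 0)"
    and transversal: "\<And>x. x \<in> unit_cube - N \<Longrightarrow> 1 / 2 \<le> (\<Sum>b\<in>Basis. e b x * w b x)"
    and \<Phi>: "\<And>y. y \<in> {a<..<c} \<Longrightarrow> (\<Phi> has_real_derivative \<phi> y) (at y)"
      "\<And>y. y \<in> {a<..<c} \<Longrightarrow> \<bar>\<Phi> y\<bar> \<le> I"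
    and \<phi>: "continuous_on UNIV \<phi>" "\<And>y. 0 \<le> \<phi> y" "\<And>y. \<phi> y \<le> 1"
  shows "integral unit_cube (\<lambda>x. \<phi> (s x)) \<le> 2 * DIM('a) * (I * (L + 2 * B))"
proof -
  define D where "D b x = \<phi> (s x) * e b x" for b x
  have \<phi>1: "\<bar>\<phi> y\<bar> \<le> 1" for y using \<phi>(2,3)[of y] by simp
  have lips: "Hs-lipschitz_on unit_cube (\<lambda>x. \<Phi> (s x))"
    using lipschitz_on_compose_antiderivative[OF s \<Phi>(1) \<phi>1] by auto
  have A: "\<bar>\<Phi> (s x)\<bar> \<le> I" if "x \<in> unit_cube" for x
    using \<Phi>(2) s(2) that by auto
  have D: "((\<lambda>t. \<Phi> (s (x + t *\<^sub>R b))) has_real_derivative D b x) (at 0)"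
    if x: "x \<in> unit_cube - N" and b: "b \<in> Basis" for x b
  proof -
    have "s x \<in> {a<..<c}" using x s(2) by auto
    then show ?thesis
      unfolding D_def using DERIV_chain2[OF _ ds[OF x b], of \<Phi> "\<phi> (s x)"] \<Phi>(1) by auto
  qed
  note div = divergence_bound[OF A lips D]
  have ints: "(\<lambda>x. \<phi> (s x) / 2) integrable_on (unit_cube - N)"
    unfolding integrable_diff_N
    by (intro integrable_continuous continuous_intros continuous_on_compose2[OF \<phi>(1)]
        lipschitz_on_continuous_on[OF s(1)]) auto
  have "integral (unit_cube - N) (\<lambda>x. \<phi> (s x) / 2)
      \<le> integral (unit_cube - N) (\<lambda>x. \<Sum>b\<in>Basis. D b x * w b x)"
  proof (rule integral_le[OF ints div(1)])
    fix x assume x: "x \<in> unit_cube - N"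
    show "\<phi> (s x) / 2 \<le> (\<Sum>b\<in>Basis. D b x * w b x)"
      using mult_left_mono[OF transversal[OF x] \<phi>(2)[of "s x"]]
      by (simp add: D_def sum_distrib_left mult.assoc)
  qed
  then show ?thesis
    using div(2) by (simp add: integral_diff_N)
qed

end

section \<open>Test functions and densities\<close>

text \<open>A point off a closed set has positive distance from it, so the tents vanish there as
  soon as j exceeds the reciprocal of that distance; on \<open>K\<close> they are constantly
  1.\<close>

lemma tent_tendsto_indicator:
  fixes K :: "'a::metric_space set"
  assumes "closed K" "K \<noteq> {}"
  shows "(\<lambda>j. max 0 (1 - real j * infdist y K)) \<longlonglongrightarrow> indicator K y"
proof (cases "y \<in> K")
  case False
  then have pos: "0 < infdist y K" using assms infdist_pos_not_in_closed by blast
  obtain J where J: "1 / infdist y K < real J" using reals_Archimedean2 by blast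
  have "max 0 (1 - real j * infdist y K) = 0" if "J \<le> j" for j
  proof -
    have "1 / infdist y K < real j" using J that by linarith
    then show ?thesis using pos by (simp add: field_simps)
  qed
  then show ?thesis
    using False by (intro tendsto_eventually) (auto simp: eventually_sequentially)
qed simp

context prob_space
begin

lemma expectation_tent_tendsto:
  fixes X :: "'a \<Rightarrow> 'b::{metric_space, second_countable_topology}"
  assumes X: "random_variable borel X" and K: "closed K" "K \<noteq> {}"
  shows "(\<lambda>j. expectation (\<lambda>\<omega>. max 0 (1 - real j * infdist (X \<omega>) K)))
    \<longlonglongrightarrow> prob (X -` K \<inter> space M)"
proof -
  note X[measurable]
  have [measurable]: "(\<lambda>y. infdist y K) \<in> borel_measurable borel"
    by (intro borel_measurable_continuous_onI continuous_intros)
  have [measurable]: "K \<in> sets borel" using K by auto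
  have "(\<lambda>j. expectation (\<lambda>\<omega>. max 0 (1 - real j * infdist (X \<omega>) K)))
      \<longlonglongrightarrow> expectation (\<lambda>\<omega>. indicator K (X \<omega>))"
    by (rule integral_dominated_convergence[where w = "\<lambda>_. 1"])
      (auto intro: tent_tendsto_indicator[OF K] simp: infdist_nonneg)
  also have "expectation (\<lambda>\<omega>. indicator K (X \<omega>) :: real)
      = expectation (indicator (X -` K \<inter> space M))"
    by (rule Bochner_Integration.integral_cong) (auto simp: indicator_def)
  finally show ?thesis by simp
qed

text \<open>Inner regularity of the law of \<open>X\<close> on a Polish space. Compact sets are
  closed, which is what the tents can approximate.\<close>

lemma prob_le_of_compact:
  fixes X :: "'a \<Rightarrow> 'b::polish_space"
  assumes X: "random_variable borel X" and A: "A \<in> sets borel"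
    and le: "\<And>K. K \<subseteq> A \<Longrightarrow> compact K \<Longrightarrow> prob (X -` K \<inter> space M) \<le> c"
  shows "prob (X -` A \<inter> space M) \<le> c"
proof -
  interpret X: prob_space "distr M borel X" using X by (rule prob_space_distr)
  have "emeasure (distr M borel X) A = (SUP K \<in> {K. K \<subseteq> A \<and> compact K}. emeasure (distr M borel X) K)"
    by (rule inner_regular) (auto intro: A X.finite_measure_axioms)
  also have "\<dots> \<le> ennreal c"
  proof (rule SUP_least)
    fix K assume "K \<in> {K. K \<subseteq> A \<and> compact K}"
    then show "emeasure (distr M borel X) K \<le> ennreal c"
      using le[of K] X by (auto simp: emeasure_distr borel_compact emeasure_eq_measure intro!: ennreal_leI)
  qed
  finally have "ennreal (prob (X -` A \<inter> space M)) \<le> ennreal c"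
    using X A by (simp add: emeasure_distr emeasure_eq_measure)
  moreover have "0 \<le> c" using le[of "{}"] by simp
  ultimately show ?thesis by simp
qed

text \<open>Tents compare the two laws on the same compact set; monotonicity then enlarges it to
  \<open>A\<close> on the side of \<open>Y\<close>, and inner regularity takes care of the side of
  \<open>X\<close>.\<close>

lemma prob_le_of_test_functions:
  fixes X Y :: "'a \<Rightarrow> 'b::polish_space"
  assumes X: "random_variable borel X" and Y: "random_variable borel Y" and A: "A \<in> sets borel"
    and le: "\<And>\<phi>. continuous_on UNIV \<phi> \<Longrightarrow> (\<And>y. 0 \<le> \<phi> y) \<Longrightarrow> (\<And>y. \<phi> y \<le> (1::real)) \<Longrightarrow>
      expectation (\<lambda>\<omega>. \<phi> (X \<omega>)) \<le> expectation (\<lambda>\<omega>. \<phi> (Y \<omega>)) + \<delta>"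
    and \<delta>: "0 \<le> \<delta>"
  shows "prob (X -` A \<inter> space M) \<le> prob (Y -` A \<inter> space M) + \<delta>"
proof (rule prob_le_of_compact[OF X A])
  fix K assume K: "K \<subseteq> A" "compact K"
  show "prob (X -` K \<inter> space M) \<le> prob (Y -` A \<inter> space M) + \<delta>"
  \<comment> \<open>\<open>infdist\<close> from the empty set is 0 by convention, so its tents would
    be constantly 1; this case is treated apart.\<close>
  proof (cases "K = {}")
    case False
    note K' = compact_imp_closed[OF K(2)] False
    have "prob (X -` K \<inter> space M) \<le> prob (Y -` K \<inter> space M) + \<delta>"
    proof (rule tendsto_le[OF _ _ expectation_tent_tendsto[OF X K']])
      show "(\<lambda>j. expectation (\<lambda>\<omega>. max 0 (1 - real j * infdist (Y \<omega>) K)) + \<delta>)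
          \<longlonglongrightarrow> prob (Y -` K \<inter> space M) + \<delta>"
        by (intro tendsto_intros expectation_tent_tendsto[OF Y K'])
    qed (auto intro!: always_eventually le continuous_intros simp: infdist_nonneg)
    also have "prob (Y -` K \<inter> space M) \<le> prob (Y -` A \<inter> space M)"
      using K Y A by (intro finite_measure_mono) auto
    finally show ?thesis by simp
  qed (use \<delta> in simp)
qed

text \<open>For compact \<open>K\<close> inside a null set, the Lebesgue integrals of the tents over
  the fixed interval decrease to the measure of a null set, and the assumed bound passes this on to
  the law of \<open>X\<close>.\<close>

lemma prob_null_of_test_functions:
  fixes X :: "'a \<Rightarrow> real"
  assumes X: "random_variable borel X" and A: "A \<in> null_sets lborel"
    and le: "\<And>\<phi>. continuous_on UNIV \<phi> \<Longrightarrow> (\<And>y. 0 \<le> \<phi> y) \<Longrightarrow> (\<And>y. \<phi> y \<le> (1::real)) \<Longrightarrow>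
      expectation (\<lambda>\<omega>. \<phi> (X \<omega>)) \<le> P * integral {a..c} \<phi>"
  shows "prob (X -` A \<inter> space M) = 0"
proof -
  have "prob (X -` A \<inter> space M) \<le> 0"
  proof (rule prob_le_of_compact[OF X])
    show "A \<in> sets borel" using A by (auto simp: null_sets_def)
    fix K assume K: "K \<subseteq> A" "compact K"
    show "prob (X -` K \<inter> space M) \<le> 0"
    proof (cases "K = {}")
      case False
      note K' = compact_imp_closed[OF K(2)] False
      let ?\<phi> = "\<lambda>j y. max 0 (1 - real j * infdist y K)"
      have cont: "continuous_on UNIV (?\<phi> j)" for j by (intro continuous_intros)
      have "(\<lambda>j. integral {a..c} (?\<phi> j)) \<longlonglongrightarrow> integral {a..c} (indicator K)"
      proof (rule dominated_convergence(2))
        show "?\<phi> j integrable_on {a..c}" for j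
          by (intro integrable_continuous_interval continuous_on_subset[OF cont]) simp
        show "(\<lambda>_. 1::real) integrable_on {a..c}" by (rule integrable_const_ivl)
      qed (auto intro: tent_tendsto_indicator[OF K'] simp: infdist_nonneg)
      moreover have "integral {a..c} (indicator K :: real \<Rightarrow> real) = 0"
      proof -
        have "negligible K"
          using A K by (meson negligible_iff_null_sets negligible_subset null_sets_completionI)
        then show ?thesis
          by (intro integral_unique has_integral_negligible[of K]) (auto simp: indicator_def)
      qed
      ultimately have "(\<lambda>j. P * integral {a..c} (?\<phi> j)) \<longlonglongrightarrow> P * 0"
        by (intro tendsto_intros) simp
      moreover have "expectation (\<lambda>\<omega>. ?\<phi> j (X \<omega>)) \<le> P * integral {a..c} (?\<phi> j)" for j
        by (rule le[OF cont]) (auto simp: infdist_nonneg)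
      ultimately have "prob (X -` K \<inter> space M) \<le> P * 0"
        by (intro tendsto_le[OF _ _ expectation_tent_tendsto[OF X K']] always_eventually allI) auto
      then show ?thesis by simp
    qed simp
  qed
  then show ?thesis using measure_nonneg[of M] by (simp add: antisym)
qed

section \<open>Existence of densities, their L^1 distance, and the uniform distribution\<close>

lemma is_pdf_exists:
  assumes X: "random_variable borel X"
    and null: "\<And>A. A \<in> null_sets lborel \<Longrightarrow> prob (X -` A \<inter> space M) = 0"
  shows "\<exists>p. is_pdf M X p"
proof -
  have X': "X \<in> measurable M lborel" using X by simp
  interpret X: prob_space "distr M lborel X" using X' by (rule prob_space_distr)
  have ac: "absolutely_continuous lborel (distr M lborel X)"
    unfolding absolutely_continuous_def
  proof
    fix A :: "real set" assume A: "A \<in> null_sets lborel"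
    then show "A \<in> null_sets (distr M lborel X)"
      using null[OF A] X by (auto simp: null_sets_def emeasure_distr emeasure_eq_measure)
  qed
  \<comment> \<open>The law is a finite measure, so its Radon-Nikodym derivative has a real-valued
    version; it is nonnegative at every point, as \<open>is_pdf\<close> demands.\<close>
  obtain D where D: "D \<in> borel_measurable lborel"
    "AE x in lborel. RN_deriv lborel (distr M lborel X) x = ennreal (D x)"
    "\<And>x. 0 \<le> D x"
    using sigma_finite_measure.real_RN_deriv[OF sigma_finite_lborel X.finite_measure_axioms ac] by auto
  have "distr M lborel X = density lborel (RN_deriv lborel (distr M lborel X))"
    using sigma_finite_measure.density_RN_deriv[OF sigma_finite_lborel ac] by simp
  also have "\<dots> = density lborel (\<lambda>x. ennreal (D x))"
    using D by (intro density_cong) auto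
  finally show ?thesis
    using D X by (intro exI[of _ D]) (auto simp: is_pdf_def distributed_def)
qed

lemma is_pdf_prob:
  assumes "is_pdf M X p" and A: "A \<in> sets borel"
  shows "integrable lborel p" "prob (X -` A \<inter> space M) = (LINT y|lborel. p y * indicator A y)"
proof -
  have p: "\<And>y. 0 \<le> p y" and D: "distributed M lborel X (\<lambda>y. ennreal (p y))"
    using assms by (auto simp: is_pdf_def)
  have X[measurable]: "X \<in> measurable M borel" using distributed_measurable[OF D] by simp
  show "integrable lborel p"
    using distributed_integrable[OF D, of "\<lambda>_. 1"] p by simp
  have "(LINT y|lborel. p y * indicator A y) = expectation (\<lambda>\<omega>. indicator A (X \<omega>))"
    using A p by (intro distributed_integral[OF D]) auto
  also have "\<dots> = expectation (indicator (X -` A \<inter> space M))"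
    by (rule Bochner_Integration.integral_cong) (auto simp: indicator_def)
  finally show "prob (X -` A \<inter> space M) = (LINT y|lborel. p y * indicator A y)"
    by simp
qed

text \<open>The set where p exceeds q and its complement each carry a difference of probabilities of
  at most \<open>\<delta>\<close>, one in each direction; hence both hypotheses and the factor
  2.\<close>

lemma is_pdf_L1_le:
  assumes p: "is_pdf M X p" and q: "is_pdf M Y q"
    and pq: "\<And>A. A \<in> sets borel \<Longrightarrow> prob (X -` A \<inter> space M) \<le> prob (Y -` A \<inter> space M) + \<delta>"
    and qp: "\<And>A. A \<in> sets borel \<Longrightarrow> prob (Y -` A \<inter> space M) \<le> prob (X -` A \<inter> space M) + \<delta>"
  shows "(LINT y|lborel. \<bar>p y - q y\<bar>) \<le> 2 * \<delta>"
proof -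
  have ip: "integrable lborel p" and iq: "integrable lborel q"
    using is_pdf_prob(1)[OF p] is_pdf_prob(1)[OF q] by auto
  then have [measurable]: "p \<in> borel_measurable borel" "q \<in> borel_measurable borel" by auto
  define A where "A = {y. q y < p y}"
  have A: "A \<in> sets borel" "- A \<in> sets borel" unfolding A_def by measurable
  have int: "integrable lborel (\<lambda>y. p y * indicator S y)" "integrable lborel (\<lambda>y. q y * indicator S y)"
    if "S \<in> sets borel" for S
    using ip iq that by (auto intro!: integrable_real_mult_indicator)
  have "(LINT y|lborel. \<bar>p y - q y\<bar>) = (LINT y|lborel. (p y * indicator A y - q y * indicator A y)
      + (q y * indicator (- A) y - p y * indicator (- A) y))"
    by (intro Bochner_Integration.integral_cong) (auto simp: A_def indicator_def)
  also have "\<dots> = (prob (X -` A \<inter> space M) - prob (Y -` A \<inter> space M))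
      + (prob (Y -` (- A) \<inter> space M) - prob (X -` (- A) \<inter> space M))"
    using A int by (simp add: is_pdf_prob(2)[OF p] is_pdf_prob(2)[OF q])
  also have "\<dots> \<le> 2 * \<delta>" using pq[OF A(1)] qp[OF A(2)] by simp
  finally show ?thesis .
qed

lemma
  fixes u :: "'b::euclidean_space \<Rightarrow> real"
  assumes u: "continuous_on unit_cube u"
    and \<alpha>: "\<And>\<omega>. \<omega> \<in> space M \<Longrightarrow> \<alpha> \<omega> \<in> unit_cube"
    and D: "distributed M lborel \<alpha> (\<lambda>x. ennreal (indicator unit_cube x / measure lborel (unit_cube :: 'b set)))"
  shows random_variable_uniform: "random_variable borel (\<lambda>\<omega>. u (\<alpha> \<omega>))"
    and expectation_uniform: "expectation (\<lambda>\<omega>. u (\<alpha> \<omega>)) = integral unit_cube u"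
proof -
  \<comment> \<open>\<open>u\<close> is controlled on the cube only. The indicator makes it Borel on
    the whole space and changes nothing along \<open>\<alpha>\<close>, whose values lie in the
    cube.\<close>
  let ?u = "\<lambda>x. indicator unit_cube x *\<^sub>R u x"
  have [measurable]: "\<alpha> \<in> measurable M borel" using distributed_measurable[OF D] by simp
  have m[measurable]: "?u \<in> borel_measurable borel"
    using u by (intro borel_measurable_continuous_on_indicator) auto
  have "random_variable borel (\<lambda>\<omega>. ?u (\<alpha> \<omega>))" by measurable
  then show "random_variable borel (\<lambda>\<omega>. u (\<alpha> \<omega>))"
    by (rule measurable_cong[THEN iffD1, rotated]) (simp add: \<alpha>)
  have "expectation (\<lambda>\<omega>. u (\<alpha> \<omega>)) = expectation (\<lambda>\<omega>. ?u (\<alpha> \<omega>))"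
    by (rule Bochner_Integration.integral_cong) (simp_all add: \<alpha>)
  also have "\<dots> = (LINT x|lborel. indicator unit_cube x / measure lborel (unit_cube :: 'b set) * ?u x)"
    by (rule distributed_integral[OF D, symmetric]) (use m in auto)
  also have "\<dots> = (LINT x : unit_cube|lborel. u x)"
    unfolding set_lebesgue_integral_def
    by (rule Bochner_Integration.integral_cong) (auto simp: content_cbox indicator_def)
  also have "\<dots> = integral unit_cube u"
    by (rule set_borel_integral_eq_integral(2))
      (unfold set_integrable_def, rule borel_integrable_compact[OF compact_cbox u])
  finally show "expectation (\<lambda>\<omega>. u (\<alpha> \<omega>)) = integral unit_cube u" .
qed

end

section \<open>Lipschitz functions and splines\<close>

lemma ex_lipschitz_mult:
  fixes f g :: "'a::metric_space \<Rightarrow> real"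
  assumes S: "compact S" and f: "\<exists>H. H-lipschitz_on S f" and g: "\<exists>H. H-lipschitz_on S g"
  shows "\<exists>H. H-lipschitz_on S (\<lambda>x. f x * g x)"
proof -
  obtain Lf Lg where L: "Lf-lipschitz_on S f" "Lg-lipschitz_on S g" using f g by auto
  have "bounded (f ` S)" "bounded (g ` S)"
    using L S by (auto intro!: compact_imp_bounded compact_continuous_image lipschitz_on_continuous_on)
  then obtain Bf Bg where B: "\<And>x. x \<in> S \<Longrightarrow> \<bar>f x\<bar> \<le> Bf" "\<And>x. x \<in> S \<Longrightarrow> \<bar>g x\<bar> \<le> Bg"
    "0 < Bf" "0 < Bg"
    unfolding bounded_pos by auto
  have "(Bf * Lg + Lf * Bg)-lipschitz_on S (\<lambda>x. f x * g x)"
  proof (rule lipschitz_onI)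
    fix x y assume xy: "x \<in> S" "y \<in> S"
    have "\<bar>f x * g x - f y * g y\<bar> \<le> \<bar>f x\<bar> * \<bar>g x - g y\<bar> + \<bar>f x - f y\<bar> * \<bar>g y\<bar>"
      by (simp add: algebra_simps flip: abs_mult)
    also have "\<dots> \<le> Bf * (Lg * dist x y) + (Lf * dist x y) * Bg"
      using lipschitz_onD[OF L(1) xy] lipschitz_onD[OF L(2) xy] B xy
        lipschitz_on_nonneg[OF L(1)]
      by (intro add_mono mult_mono) (auto simp: dist_real_def)
    finally show "dist (f x * g x) (f y * g y) \<le> (Bf * Lg + Lf * Bg) * dist x y"
      by (simp add: dist_real_def algebra_simps)
  next
    show "0 \<le> Bf * Lg + Lf * Bg"
      using B(3,4) lipschitz_on_nonneg[OF L(1)] lipschitz_on_nonneg[OF L(2)] by simp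
  qed
  then show ?thesis by blast
qed

lemma ex_lipschitz_prod:
  fixes f :: "'i \<Rightarrow> 'a::metric_space \<Rightarrow> real"
  assumes S: "compact S" and f: "\<And>i. i \<in> I \<Longrightarrow> \<exists>H. H-lipschitz_on S (f i)"
  shows "\<exists>H. H-lipschitz_on S (\<lambda>x. \<Prod>i\<in>I. f i x)"
  using f
  by (induction I rule: infinite_finite_induct)
    (auto intro!: ex_lipschitz_mult[OF S] intro: lipschitz_on_constant)

lemma ex_lipschitz_sum:
  fixes f :: "'i \<Rightarrow> 'a::metric_space \<Rightarrow> real"
  assumes f: "\<And>i. i \<in> I \<Longrightarrow> \<exists>H. H-lipschitz_on S (f i)"
  shows "\<exists>H. H-lipschitz_on S (\<lambda>x. \<Sum>i\<in>I. f i x)"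
  using f
proof (induction I rule: infinite_finite_induct)
  case (insert i I)
  obtain H1 where "H1-lipschitz_on S (f i)" using insert.prems by auto
  moreover obtain H2 where "H2-lipschitz_on S (\<lambda>x. \<Sum>i\<in>I. f i x)" using insert by auto
  ultimately have "(H1 + H2)-lipschitz_on S (\<lambda>x. f i x + (\<Sum>i\<in>I. f i x))"
    by (rule lipschitz_on_add)
  with insert show ?case by auto
qed (auto intro: lipschitz_on_constant)

lemma ex_lipschitz_inverse:
  fixes f :: "'a::metric_space \<Rightarrow> real"
  assumes f: "\<exists>H. H-lipschitz_on S f" and c: "0 < c" "\<And>x. x \<in> S \<Longrightarrow> c \<le> f x"
  shows "\<exists>H. H-lipschitz_on S (\<lambda>x. inverse (f x))"
proof -
  obtain H where H: "H-lipschitz_on S f" using f by blast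
  have "(H / c\<^sup>2)-lipschitz_on S (\<lambda>x. inverse (f x))"
  proof (rule lipschitz_onI)
    fix x y assume xy: "x \<in> S" "y \<in> S"
    then have pos: "c \<le> f x" "c \<le> f y" by (auto simp: c)
    then have "\<bar>inverse (f x) - inverse (f y)\<bar> = \<bar>f x - f y\<bar> / (f x * f y)"
      using c(1) by (simp add: field_simps abs_mult abs_minus_commute)
    also have "\<dots> \<le> (H * dist x y) / (c * c)"
      using lipschitz_onD[OF H xy] pos c(1)
      by (intro frac_le mult_mono) (auto simp: dist_real_def)
    finally show "dist (inverse (f x)) (inverse (f y)) \<le> H / c\<^sup>2 * dist x y"
      by (simp add: dist_real_def power2_eq_square)
  qed (use lipschitz_on_nonneg[OF H] in auto)
  then show ?thesis by blast
qed

text \<open>The domains depend on the index because the lemma has two uses: one function on the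
  cells of a grid, and the components of a field on one cube.\<close>

lemma ex_uniform_lipschitz:
  fixes f :: "'i \<Rightarrow> 'a::metric_space \<Rightarrow> 'b::metric_space"
  assumes "finite I" and ex: "\<And>i. i \<in> I \<Longrightarrow> \<exists>H. H-lipschitz_on (U i) (f i)"
  shows "\<exists>H\<ge>0. \<forall>i\<in>I. H-lipschitz_on (U i) (f i)"
proof -
  obtain H where H: "\<And>i. i \<in> I \<Longrightarrow> (H i)-lipschitz_on (U i) (f i)"
    using ex by metis
  have H0: "0 \<le> H i" if "i \<in> I" for i using H[OF that] by (rule lipschitz_on_nonneg)
  have "(\<Sum>i\<in>I. H i)-lipschitz_on (U i) (f i)" if "i \<in> I" for i
    using H[OF that] by (rule lipschitz_on_le) (use that H0 assms(1) in \<open>auto intro!: member_le_sum\<close>)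
  moreover have "0 \<le> (\<Sum>i\<in>I. H i)" using H0 by (rule sum_nonneg)
  ultimately show ?thesis by blast
qed

text \<open>The sum of bounds on the partials bounds the operator norm of the derivative, and the
  mean value inequality holds on convex sets. Derivatives are taken within \<open>S\<close>, so
  boundary points are covered.\<close>

lemma ex_lipschitz_of_partials:
  fixes g :: "'a::euclidean_space \<Rightarrow> real"
  assumes S: "convex S" "compact S" and diff: "g differentiable_on S"
    and cont: "\<And>b. b \<in> Basis \<Longrightarrow> continuous_on S (partial_deriv S b g)"
  shows "\<exists>H. H-lipschitz_on S g"
proof -
  have "\<exists>B>0. \<forall>x\<in>S. \<bar>partial_deriv S b g x\<bar> \<le> B" if "b \<in> Basis" for b
    using compact_imp_bounded[OF compact_continuous_image[OF cont[OF that] S(2)]]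
    unfolding bounded_pos by auto
  then obtain B where B: "\<And>b. b \<in> Basis \<Longrightarrow> 0 < B b"
    "\<And>b x. b \<in> Basis \<Longrightarrow> x \<in> S \<Longrightarrow> \<bar>partial_deriv S b g x\<bar> \<le> B b"
    by metis
  have der: "(g has_derivative frechet_derivative g (at x within S)) (at x within S)" if "x \<in> S" for x
    using diff that frechet_derivative_works by (auto simp: differentiable_on_def)
  have "onorm (frechet_derivative g (at x within S)) \<le> (\<Sum>b\<in>Basis. B b)" if x: "x \<in> S" for x
  proof (rule onorm_le)
    fix h :: 'a
    let ?F = "frechet_derivative g (at x within S)"
    interpret F: bounded_linear ?F using der[OF x] by (rule has_derivative_bounded_linear)
    have "?F h = ?F (\<Sum>b\<in>Basis. (h \<bullet> b) *\<^sub>R b)" by (simp add: euclidean_representation)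
    also have "\<dots> = (\<Sum>b\<in>Basis. (h \<bullet> b) * ?F b)" by (simp add: F.sum F.scaleR)
    also have "norm \<dots> \<le> (\<Sum>b\<in>Basis. norm h * B b)"
      using B(2)[OF _ x] Basis_le_norm[of _ h]
      by (intro norm_sum[THEN order_trans] sum_mono)
        (auto simp: abs_mult partial_deriv_def intro!: mult_mono)
    finally show "norm (?F h) \<le> (\<Sum>b\<in>Basis. B b) * norm h"
      by (simp add: sum_distrib_left mult.commute)
  qed
  from differentiable_bound[OF S(1) der this]
  have "(\<Sum>b\<in>Basis. B b)-lipschitz_on S g"
    using B(1)[THEN less_imp_le] by (intro lipschitz_onI) (auto simp: dist_norm intro: sum_nonneg)
  then show ?thesis by blast
qed

lemma partial_deriv_interior:
  fixes h :: "'a::euclidean_space \<Rightarrow> real"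
  assumes diff: "h differentiable_on S" and x: "x \<in> interior S"
  shows "((\<lambda>t. h (x + t *\<^sub>R b)) has_real_derivative partial_deriv S b h x) (at 0)"
proof -
  let ?F = "frechet_derivative h (at x within S)"
  have "(h has_derivative ?F) (at x within S)"
    using diff x interior_subset frechet_derivative_works by (fastforce simp: differentiable_on_def)
  \<comment> \<open>The base point is written as the value at 0 of the line through x, the form in
    which the chain rule expects it.\<close>
  then have h: "(h has_derivative ?F) (at (x + 0 *\<^sub>R b))"
    using at_within_interior[OF x] by simp
  have "((\<lambda>t. x + t *\<^sub>R b) has_derivative (\<lambda>t. t *\<^sub>R b)) (at 0)"
    by (auto intro!: derivative_eq_intros)
  from has_derivative_compose[OF this h]
  have "((\<lambda>t. h (x + t *\<^sub>R b)) has_derivative (\<lambda>t. ?F (t *\<^sub>R b))) (at 0)" .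
  then show ?thesis
    unfolding has_field_derivative_def partial_deriv_def
    using linear_cmul[OF has_derivative_linear[OF h]] by (simp add: mult.commute[of _ "?F b"] mult_commute_abs)
qed

lemma C_k_on_partials:
  assumes "C_k_on k S f" "2 \<le> k"
  shows "f differentiable_on S"
    and "\<And>b. b \<in> Basis \<Longrightarrow> continuous_on S (partial_deriv S b f)"
    and "\<And>b. b \<in> Basis \<Longrightarrow> partial_deriv S b f differentiable_on S"
    and "\<And>b c. b \<in> Basis \<Longrightarrow> c \<in> Basis \<Longrightarrow> continuous_on S (partial_deriv S c (partial_deriv S b f))"
proof -
  have d: "iterated_partial S bs f differentiable_on S" if "set bs \<subseteq> Basis" "length bs < 2" for bs
    using assms that by (auto simp: C_k_on_def)
  have c: "continuous_on S (iterated_partial S bs f)" if "set bs \<subseteq> Basis" "length bs \<le> 2" for bs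
    using assms that by (auto simp: C_k_on_def)
  show "f differentiable_on S"
    using d[of "[]"] by (auto simp: iterated_partial_def)
  show "continuous_on S (partial_deriv S b f)" if "b \<in> Basis" for b
    using c[of "[b]"] that by (auto simp: iterated_partial_def)
  show "partial_deriv S b f differentiable_on S" if "b \<in> Basis" for b
    using d[of "[b]"] that by (auto simp: iterated_partial_def)
  \<comment> \<open>\<open>foldr\<close> applies the last list entry first, hence the order
    \<open>[c, b]\<close>.\<close>
  show "continuous_on S (partial_deriv S c (partial_deriv S b f))" if "b \<in> Basis" "c \<in> Basis" for b c
    using c[of "[c, b]"] that by (auto simp: iterated_partial_def)
qed

section \<open>Grids, splines and the knot hyperplanes\<close>

lemma grid_cover:
  assumes "is_grid n \<alpha>" "t \<in> {0..1}"
  obtains j where "j \<in> {1..<n}" "t \<in> {\<alpha> j..\<alpha> (j + 1)}"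
proof -
  have "\<exists>j\<in>{1..<k}. t \<in> {\<alpha> j..\<alpha> (j + 1)}" if "2 \<le> k" "\<alpha> 1 \<le> t" "t \<le> \<alpha> k" for k
    using that
  proof (induction k rule: nat_induct_at_least)
    case base
    then show ?case by (auto simp: numeral_2_eq_2)
  next
    case (Suc k)
    show ?case
    proof (cases "t \<le> \<alpha> k")
      case True
      with Suc obtain j where "j \<in> {1..<k}" "t \<in> {\<alpha> j..\<alpha> (j + 1)}" by auto
      then show ?thesis by (intro bexI[of _ j]) auto
    qed (use Suc in \<open>auto intro!: bexI[of _ k]\<close>)
  qed
  from this[of n] assms that show thesis by (auto simp: is_grid_def)
qed

lemma grid_bounds:
  assumes "is_grid n \<alpha>" "j \<in> {1..n}"
  shows "\<alpha> j \<in> {0..1}"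
proof -
  have mono: "\<alpha> i \<le> \<alpha> k" if "1 \<le> i" "i \<le> k" "k \<le> n" for i k
    using that(2,3)
  proof (induction k rule: dec_induct)
    case (step k)
    then have "\<alpha> k < \<alpha> (k + 1)" using assms(1) that(1) by (auto simp: is_grid_def)
    with step show ?case by simp
  qed simp
  show ?thesis using mono[of 1 j] mono[of j n] assms by (auto simp: is_grid_def)
qed

lemma spline_1d_piece:
  assumes "spline_1d m n \<alpha> \<phi>" "j \<in> {1..<n}"
  obtains p where "degree p \<le> m" "\<And>t. t \<in> {\<alpha> j..\<alpha> (j + 1)} \<Longrightarrow> \<phi> t = poly p t"
  using assms unfolding spline_1d_def by blast

text \<open>The polynomial pieces are used rather than the smoothness class, which for m = 1 is only
  C^0. Each piece has bounded derivative on its closed cell, and finitely many closed cells cover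
  the interval.\<close>

lemma spline_1d_lipschitz:
  assumes grid: "is_grid n \<alpha>" and \<phi>: "spline_1d m n \<alpha> \<phi>"
  shows "\<exists>H. H-lipschitz_on {0..1} \<phi>"
proof -
  have "\<exists>H. H-lipschitz_on {\<alpha> j..\<alpha> (j + 1)} \<phi>" if j: "j \<in> {1..<n}" for j
  proof -
    obtain p where p: "\<And>t. t \<in> {\<alpha> j..\<alpha> (j + 1)} \<Longrightarrow> \<phi> t = poly p t"
      by (rule spline_1d_piece[OF \<phi> j]) blast
    have "bounded (poly (pderiv p) ` {\<alpha> j..\<alpha> (j + 1)})"
      by (intro compact_imp_bounded compact_continuous_image continuous_intros) auto
    then obtain B where B: "0 < B" "\<And>t. t \<in> {\<alpha> j..\<alpha> (j + 1)} \<Longrightarrow> \<bar>poly (pderiv p) t\<bar> \<le> B"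
      unfolding bounded_pos by auto
    have "B-lipschitz_on {\<alpha> j..\<alpha> (j + 1)} (poly p)"
    proof (rule lipschitz_onI)
      fix x y assume "x \<in> {\<alpha> j..\<alpha> (j + 1)}" "y \<in> {\<alpha> j..\<alpha> (j + 1)}"
      then show "dist (poly p x) (poly p y) \<le> B * dist x y"
        using field_differentiable_bound[of "{\<alpha> j..\<alpha> (j + 1)}" "poly p" "poly (pderiv p)" B x y] B
        by (auto simp: dist_norm intro: has_field_derivative_at_within[OF poly_DERIV])
    qed (use B in simp)
    then show ?thesis
      using p lipschitz_on_transform[of B "{\<alpha> j..\<alpha> (j + 1)}" "poly p" \<phi>] by auto
  qed
  then obtain H where H: "0 \<le> H" "\<And>j. j \<in> {1..<n} \<Longrightarrow> H-lipschitz_on {\<alpha> j..\<alpha> (j + 1)} \<phi>"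
    using ex_uniform_lipschitz[of "{1..<n}" "\<lambda>j. {\<alpha> j..\<alpha> (j + 1)}" "\<lambda>_. \<phi>"] by auto
  have "H-lipschitz_on {0..1} \<phi>"
  proof (rule lipschitz_on_closed_Union[where I = "{1..<n}" and U = "\<lambda>j. {\<alpha> j..\<alpha> (j + 1)}"])
    show "{0..1} \<subseteq> (\<Union>j\<in>{1..<n}. {\<alpha> j..\<alpha> (j + 1)})"
      using grid_cover[OF grid] by blast
  qed (use H in auto)
  then show ?thesis by blast
qed

lemma open_cell:
  assumes grid: "is_grid n \<alpha>" and t: "t \<in> {0..1}" "t \<notin> \<alpha> ` {1..n}"
  obtains j where "j \<in> {1..<n}" "\<alpha> j < t" "t < \<alpha> (j + 1)"
proof -
  obtain j where j: "j \<in> {1..<n}" "t \<in> {\<alpha> j..\<alpha> (j + 1)}" using grid_cover[OF grid t(1)] .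
  then have "t \<noteq> \<alpha> j" "t \<noteq> \<alpha> (j + 1)" using t(2) by (auto simp: image_iff)
  with j show thesis by (intro that[of j]) auto
qed

lemma spline_1d_has_derivative:
  assumes grid: "is_grid n \<alpha>" and \<phi>: "spline_1d m n \<alpha> \<phi>"
    and t: "t \<in> {0..1}" "t \<notin> \<alpha> ` {1..n}"
  shows "\<exists>D. (\<phi> has_real_derivative D) (at t)"
proof -
  obtain j where j: "j \<in> {1..<n}" "\<alpha> j < t" "t < \<alpha> (j + 1)" using open_cell[OF grid t] .
  obtain p where p: "\<And>t. t \<in> {\<alpha> j..\<alpha> (j + 1)} \<Longrightarrow> \<phi> t = poly p t"
    by (rule spline_1d_piece[OF \<phi> j(1)]) blast
  have "(\<phi> has_real_derivative poly (pderiv p) t) (at t)"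
    using poly_DERIV[of p t] by (rule has_field_derivative_transform_within_open[of _ _ _ "{\<alpha> j<..<\<alpha> (j + 1)}"])
      (use j p in auto)
  then show ?thesis by blast
qed

text \<open>The exceptional set of \<open>cube_vector_field\<close> in the application. Inside the
  cube its complement is the union of the open grid cells, where a tensor-product spline is a
  polynomial. In contrast to \<open>tensor_grid\<close>, one coordinate at a knot is enough.\<close>

definition knot_set :: "nat \<Rightarrow> (nat \<Rightarrow> real) \<Rightarrow> 'a::euclidean_space set" where
  "knot_set n \<alpha> = {x. \<exists>b\<in>Basis. x \<bullet> b \<in> \<alpha> ` {1..n}}"

lemma negligible_knot_set: "negligible (knot_set n \<alpha> :: 'a::euclidean_space set)"
proof -
  have "knot_set n \<alpha> = (\<Union>b\<in>(Basis::'a set). \<Union>c\<in>\<alpha> ` {1..n}. {x. x \<bullet> b = c})"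
    by (auto simp: knot_set_def)
  moreover have "negligible (\<Union>c\<in>\<alpha> ` {1..n}. {x. x \<bullet> b = c})" if "b \<in> Basis" for b :: 'a
    using that by (intro negligible_Union) (auto intro: negligible_standard_hyperplane)
  ultimately show ?thesis by (metis (no_types, lifting) finite_Basis finite_imageI imageE negligible_Union)
qed

text \<open>0 and 1 are knots, so removing the knot hyperplanes also removes the faces of the cube,
  where derivatives would be one-sided.\<close>

lemma off_knot_set:
  assumes grid: "is_grid n \<alpha>" and x: "x \<in> unit_cube - knot_set n \<alpha>" and b: "b \<in> Basis"
  shows "0 < x \<bullet> b" "x \<bullet> b < 1" "x \<bullet> b \<notin> \<alpha> ` {1..n}"
proof -
  show k: "x \<bullet> b \<notin> \<alpha> ` {1..n}" using x b by (auto simp: knot_set_def)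
  have "x \<bullet> b \<noteq> 0" "x \<bullet> b \<noteq> 1"
    using k grid by (auto simp: is_grid_def image_iff)
  moreover have "0 \<le> x \<bullet> b" "x \<bullet> b \<le> 1" using x b by (auto simp: mem_box)
  ultimately show "0 < x \<bullet> b" "x \<bullet> b < 1" by auto
qed

lemma off_knot_set_interior:
  assumes "is_grid n \<alpha>" "x \<in> unit_cube - knot_set n \<alpha>"
  shows "x \<in> interior unit_cube"
  using off_knot_set[OF assms] by (auto simp: interior_cbox mem_box)

lemma tensor_product_spline_lipschitz:
  fixes s :: "'a::euclidean_space \<Rightarrow> real"
  assumes grid: "is_grid n \<alpha>" and s: "tensor_product_spline m n \<alpha> s"
  shows "\<exists>H. H-lipschitz_on unit_cube s"
proof -
  obtain r and \<phi> :: "nat \<Rightarrow> 'a \<Rightarrow> real \<Rightarrow> real"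
    where \<phi>: "\<And>k b. k < r \<Longrightarrow> b \<in> Basis \<Longrightarrow> spline_1d m n \<alpha> (\<phi> k b)"
      and s: "\<And>x. x \<in> unit_cube \<Longrightarrow> s x = (\<Sum>k<r. \<Prod>b\<in>Basis. \<phi> k b (x \<bullet> b))"
    using s unfolding tensor_product_spline_def by blast
  have "\<exists>H. H-lipschitz_on unit_cube (\<lambda>x. \<phi> k b (x \<bullet> b))" if kb: "k < r" "b \<in> Basis" for k b
  proof -
    obtain H where "H-lipschitz_on {0..1} (\<phi> k b)"
      using spline_1d_lipschitz[OF grid \<phi>[OF kb]] by blast
    then have "H-lipschitz_on ((\<lambda>x. x \<bullet> b) ` unit_cube) (\<phi> k b)"
      by (rule lipschitz_on_subset) (use kb in \<open>auto simp: mem_box\<close>)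
    moreover have "1-lipschitz_on unit_cube (\<lambda>x::'a. x \<bullet> b)"
      using kb by (intro lipschitz_onI)
        (auto simp: dist_norm inner_diff_left[symmetric] intro: Basis_le_norm)
    ultimately show ?thesis using lipschitz_on_compose2 by blast
  qed
  then have "\<exists>H. H-lipschitz_on unit_cube (\<lambda>x. \<Sum>k<r. \<Prod>b\<in>Basis. \<phi> k b (x \<bullet> b))"
    by (intro ex_lipschitz_sum ex_lipschitz_prod compact_cbox) auto
  then obtain H where "H-lipschitz_on unit_cube (\<lambda>x. \<Sum>k<r. \<Prod>b\<in>Basis. \<phi> k b (x \<bullet> b))" by blast
  then show ?thesis using lipschitz_on_transform[of H unit_cube _ s] s by blast
qed

lemma tensor_product_spline_has_partial:
  fixes s :: "'a::euclidean_space \<Rightarrow> real"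
  assumes grid: "is_grid n \<alpha>" and s: "tensor_product_spline m n \<alpha> s"
    and x: "x \<in> unit_cube - knot_set n \<alpha>"
  shows "\<exists>e. ((\<lambda>t. s (x + t *\<^sub>R b)) has_real_derivative e) (at 0)"
proof -
  obtain r and \<phi> :: "nat \<Rightarrow> 'a \<Rightarrow> real \<Rightarrow> real"
    where \<phi>: "\<And>k b. k < r \<Longrightarrow> b \<in> Basis \<Longrightarrow> spline_1d m n \<alpha> (\<phi> k b)"
      and s: "\<And>x. x \<in> unit_cube \<Longrightarrow> s x = (\<Sum>k<r. \<Prod>b\<in>Basis. \<phi> k b (x \<bullet> b))"
    using s unfolding tensor_product_spline_def by blast
  have "\<exists>D. ((\<lambda>t. \<phi> k c ((x + t *\<^sub>R b) \<bullet> c)) has_real_derivative D) (at 0)"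
    if kc: "k < r" "c \<in> Basis" for k c
  proof -
    obtain D where D: "(\<phi> k c has_real_derivative D) (at ((x + 0 *\<^sub>R b) \<bullet> c))"
      using spline_1d_has_derivative[OF grid \<phi>[OF kc], of "x \<bullet> c"] off_knot_set[OF grid x kc(2)]
      by auto
    have "((\<lambda>t. (x + t *\<^sub>R b) \<bullet> c) has_real_derivative (b \<bullet> c)) (at 0)"
      by (auto simp: inner_add_left intro!: derivative_eq_intros)
    from DERIV_chain2[OF D this] show ?thesis by blast
  qed
  then obtain D where D: "\<And>k c. k \<in> {..<r} \<Longrightarrow> c \<in> Basis \<Longrightarrow>
      ((\<lambda>t. \<phi> k c ((x + t *\<^sub>R b) \<bullet> c)) has_real_derivative D k c) (at 0)"
    by (metis lessThan_iff)
  \<comment> \<open>The witness stays schematic and is assembled by the sum and product rules; only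
    its existence matters.\<close>
  have "\<exists>e. ((\<lambda>t. \<Sum>k<r. \<Prod>c\<in>Basis. \<phi> k c ((x + t *\<^sub>R b) \<bullet> c)) has_real_derivative e) (at 0)"
    by (rule exI, rule DERIV_sum, rule has_field_derivative_prod, rule D)
  then obtain e
    where e: "((\<lambda>t. \<Sum>k<r. \<Prod>c\<in>Basis. \<phi> k c ((x + t *\<^sub>R b) \<bullet> c)) has_real_derivative e) (at 0)"
    by blast
  \<comment> \<open>The product formula for \<open>s\<close> holds on the cube only; since x is an
    interior point, it holds for all t near 0.\<close>
  have "open ((\<lambda>t. x + t *\<^sub>R b) -` box 0 One)"
    by (intro open_vimage open_box continuous_intros)
  then have "((\<lambda>t. s (x + t *\<^sub>R b)) has_real_derivative e) (at 0)"
  proof (rule has_field_derivative_transform_within_open[OF e])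
    show "0 \<in> (\<lambda>t. x + t *\<^sub>R b) -` box 0 One"
      using off_knot_set_interior[OF grid x] by (simp add: interior_cbox)
    fix t assume "t \<in> (\<lambda>t. x + t *\<^sub>R b) -` box 0 One"
    then have "x + t *\<^sub>R b \<in> unit_cube" using box_subset_cbox by auto
    then show "(\<Sum>k<r. \<Prod>c\<in>Basis. \<phi> k c ((x + t *\<^sub>R b) \<bullet> c)) = s (x + t *\<^sub>R b)"
      by (rule s[symmetric])
  qed
  then show ?thesis by blast
qed

text \<open>For \<open>m = 1\<close> the interpolation estimate says nothing about derivatives; but \<open>s\<close> is affine
  across each cell in every coordinate direction, so that its slope is the difference quotient of
  values that are within \<open>C h\<^sup>2\<close> of those of \<open>f\<close>.\<close>

lemma linear_spline_partial_error:
  fixes f s :: "'a::euclidean_space \<Rightarrow> real"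
  assumes grid: "is_grid n \<alpha>" and s: "tensor_product_spline 1 n \<alpha> s"
    and step: "\<And>j. j \<in> {1..<n} \<Longrightarrow> \<alpha> (j + 1) - \<alpha> j = h"
    and f: "f differentiable_on unit_cube"
    and b: "b \<in> Basis"
    and L: "L-lipschitz_on unit_cube (partial_deriv unit_cube b f)"
    and err: "\<And>y. y \<in> unit_cube \<Longrightarrow> \<bar>f y - s y\<bar> \<le> C * h\<^sup>2"
    and x: "x \<in> unit_cube - knot_set n \<alpha>"
    and e: "((\<lambda>t. s (x + t *\<^sub>R b)) has_real_derivative e) (at 0)"
  shows "\<bar>e - partial_deriv unit_cube b f x\<bar> \<le> (L + 2 * C) * h"
proof -
  let ?g = "partial_deriv unit_cube b f"
  obtain r and \<phi> :: "nat \<Rightarrow> 'a \<Rightarrow> real \<Rightarrow> real"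
    where \<phi>: "\<And>k b. k < r \<Longrightarrow> b \<in> Basis \<Longrightarrow> spline_1d 1 n \<alpha> (\<phi> k b)"
      and s: "\<And>x. x \<in> unit_cube \<Longrightarrow> s x = (\<Sum>k<r. \<Prod>b\<in>Basis. \<phi> k b (x \<bullet> b))"
    using s unfolding tensor_product_spline_def by blast
  note off = off_knot_set[OF grid x]
  define t0 where "t0 = x \<bullet> b"
  obtain j where j: "j \<in> {1..<n}" "\<alpha> j < t0" "t0 < \<alpha> (j + 1)"
    using open_cell[OF grid, of t0] off[OF b] by (auto simp: t0_def)
  let ?I = "{\<alpha> j..\<alpha> (j + 1)}"
  have I01: "?I \<subseteq> {0..1}"
    using grid_bounds[OF grid, of j] grid_bounds[OF grid, of "j + 1"] j by auto
  have h: "\<alpha> (j + 1) = \<alpha> j + h" "0 < h" using step[OF j(1)] j by auto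
  \<comment> \<open>The line through x in direction b, parametrized by its b-coordinate, so that
    \<open>l t0\<close> is x.\<close>
  define l where "l y = x + (y - t0) *\<^sub>R b" for y
  have l_coord: "l y \<bullet> c = (if c = b then y else x \<bullet> c)" if "c \<in> Basis" for y c
    using that b by (auto simp: l_def t0_def inner_add_left inner_Basis)
  have l_cube: "l y \<in> unit_cube" if "y \<in> {0..1}" for y
    using that x by (auto simp: mem_box l_coord)
  have l_interior: "l y \<in> interior unit_cube" if "y \<in> {0<..<1}" for y
    using that off by (auto simp: interior_cbox mem_box l_coord)
  have l_deriv: "((\<lambda>y. u (l y)) has_real_derivative d) (at y)"
    if "((\<lambda>t. u (l y + t *\<^sub>R b)) has_real_derivative d) (at 0)" for u :: "'a \<Rightarrow> real" and d y
  proof -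
    have eq: "l y + (z - y) *\<^sub>R b = l z" for z by (simp add: l_def algebra_simps)
    have "((\<lambda>z. z - y) has_real_derivative 1) (at y)"
      by (auto intro!: derivative_eq_intros)
    then show ?thesis
      using DERIV_chain2[of "\<lambda>t. u (l y + t *\<^sub>R b)" d "\<lambda>z. z - y" y 1 UNIV] that by (simp add: eq)
  qed
  have "\<exists>c0 c1. \<forall>y\<in>?I. \<phi> k b y = c0 + c1 * y" if k: "k < r" for k
  proof -
    obtain p where p: "degree p \<le> 1" "\<And>t. t \<in> ?I \<Longrightarrow> \<phi> k b t = poly p t"
      by (rule spline_1d_piece[OF \<phi>[OF k b] j(1)]) blast
    obtain c0 c1 where "p = [:c0, c1:]"
      using degree_eq_zeroE degree1_coeffs p(1) by (metis le_eq_less_or_eq less_one pCons_0_0)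
    then show ?thesis using p(2) by (intro exI[of _ c0] exI[of _ c1]) (simp add: mult.commute)
  qed
  then obtain c0 c1 where c: "\<And>k y. k \<in> {..<r} \<Longrightarrow> y \<in> ?I \<Longrightarrow> \<phi> k b y = c0 k + c1 k * y"
    by (metis lessThan_iff)
  \<comment> \<open>The factors in the other coordinates are constant along the line, so only the
    affine factor in direction b varies.\<close>
  define q where "q k = (\<Prod>c\<in>Basis - {b}. \<phi> k c (x \<bullet> c))" for k
  define a0 a1 where "a0 = (\<Sum>k<r. c0 k * q k)" and "a1 = (\<Sum>k<r. c1 k * q k)"
  have affine: "s (l y) = a0 + a1 * y" if y: "y \<in> ?I" for y
  proof -
    have "s (l y) = (\<Sum>k<r. \<Prod>c\<in>Basis. \<phi> k c (l y \<bullet> c))"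
      using y I01 by (intro s l_cube) auto
    also have "\<dots> = (\<Sum>k<r. (c0 k + c1 k * y) * q k)"
    proof (rule sum.cong[OF refl])
      fix k assume k: "k \<in> {..<r}"
      have "(\<Prod>c\<in>Basis. \<phi> k c (l y \<bullet> c)) = \<phi> k b (l y \<bullet> b) * (\<Prod>c\<in>Basis - {b}. \<phi> k c (l y \<bullet> c))"
        using b by (intro prod.remove) auto
      also have "(\<Prod>c\<in>Basis - {b}. \<phi> k c (l y \<bullet> c)) = q k"
        unfolding q_def by (rule prod.cong) (auto simp: l_coord)
      finally show "(\<Prod>c\<in>Basis. \<phi> k c (l y \<bullet> c)) = (c0 k + c1 k * y) * q k"
        using b c[OF k y] by (simp add: l_coord)
    qed
    also have "\<dots> = a0 + a1 * y"
      by (simp add: a0_def a1_def sum.distrib sum_distrib_left algebra_simps)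
    finally show ?thesis .
  qed
  have e_eq: "e = a1"
  proof (rule DERIV_unique)
    show "((\<lambda>y. s (l y)) has_real_derivative e) (at t0)"
      using e by (intro l_deriv) (simp add: l_def)
    have "((\<lambda>y. a0 + a1 * y) has_real_derivative a1) (at t0)"
      by (auto intro!: derivative_eq_intros)
    then show "((\<lambda>y. s (l y)) has_real_derivative a1) (at t0)"
      by (rule has_field_derivative_transform_within_open[of _ _ _ "{\<alpha> j<..<\<alpha> (j + 1)}"])
        (use j affine in auto)
  qed
  have slope: "e * h = s (l (\<alpha> (j + 1))) - s (l (\<alpha> j))"
    using affine[of "\<alpha> (j + 1)"] affine[of "\<alpha> j"] h e_eq by (simp add: algebra_simps)
  have f_deriv: "((\<lambda>y. f (l y)) has_real_derivative ?g (l y)) (at y)" if "\<alpha> j < y" "y < \<alpha> (j + 1)" for y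
    using that I01 h by (intro l_deriv partial_deriv_interior[OF f] l_interior) auto
  have "continuous_on ?I (\<lambda>y. f (l y))"
    by (rule continuous_on_compose2[OF differentiable_imp_continuous_on[OF f]])
      (use I01 l_cube in \<open>auto simp: l_def intro!: continuous_intros\<close>)
  \<comment> \<open>Both slopes belong to the whole cell: that of \<open>s\<close> is constant
    there, that of \<open>f\<close> is attained at \<open>\<xi>\<close>, which is at most h away
    from x and so costs L h.\<close>
  from MVT[OF _ this] obtain \<xi> d where \<xi>: "\<alpha> j < \<xi>" "\<xi> < \<alpha> (j + 1)"
    "((\<lambda>y. f (l y)) has_real_derivative d) (at \<xi>)"
    "f (l (\<alpha> (j + 1))) - f (l (\<alpha> j)) = (\<alpha> (j + 1) - \<alpha> j) * d"
    using f_deriv h by (force simp: real_differentiable_def)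
  then have d: "d = ?g (l \<xi>)" using DERIV_unique f_deriv by blast
  have "dist (l \<xi>) x = \<bar>\<xi> - t0\<bar>" using b by (simp add: l_def dist_norm)
  also have "\<dots> \<le> h" using \<xi>(1,2) j h by auto
  finally have dist: "dist (l \<xi>) x \<le> h" .
  have "\<bar>d - ?g x\<bar> \<le> L * dist (l \<xi>) x"
    using lipschitz_onD[OF L, of "l \<xi>" x] l_cube[of \<xi>] \<xi>(1,2) I01 x h d by (auto simp: dist_real_def)
  also have "\<dots> \<le> L * h" using dist lipschitz_on_nonneg[OF L] by (rule mult_left_mono)
  finally have "\<bar>d - ?g x\<bar> \<le> L * h" .
  \<comment> \<open>In dimension above 1 the endpoints of the segment are not grid points, so
    interpolation gives no equality there. Each endpoint contributes an error of C h^2, and division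
    by the cell width h leaves 2 C h.\<close>
  moreover have "\<bar>e - d\<bar> \<le> 2 * C * h"
  proof -
    have "\<bar>e - d\<bar> * h = \<bar>(s (l (\<alpha> (j + 1))) - f (l (\<alpha> (j + 1)))) - (s (l (\<alpha> j)) - f (l (\<alpha> j)))\<bar>"
      using slope \<xi>(4) h by (simp add: abs_mult_pos' abs_mult_pos algebra_simps)
    also have "\<dots> \<le> 2 * C * h * h"
      using err[OF l_cube, of "\<alpha> (j + 1)"] err[OF l_cube, of "\<alpha> j"] I01 h
      by (auto simp: power2_eq_square)
    finally show ?thesis using h(2) by simp
  qed
  ultimately show ?thesis by (simp add: algebra_simps)
qed

section \<open>The error of the gradient on the uniform grid\<close>

lemma mesh_size_uniform_grid:
  assumes "2 \<le> n"
  shows "mesh_size n (uniform_grid n) = 1 / (real n - 1)"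
    and "uniform_grid n (j + 1) - uniform_grid n j = 1 / (real n - 1)"
proof -
  show *: "uniform_grid n (j + 1) - uniform_grid n j = 1 / (real n - 1)" for j
    using assms by (simp add: uniform_grid_def diff_divide_distrib[symmetric])
  have "(\<lambda>j. \<bar>uniform_grid n (j + 1) - uniform_grid n j\<bar>) ` {1..<n} = {1 / (real n - 1)}"
    using assms unfolding * by (auto simp: image_constant_conv)
  then show "mesh_size n (uniform_grid n) = 1 / (real n - 1)"
    by (simp add: mesh_size_def)
qed

text \<open>For m of at least 2 the interpolation estimate covers first derivatives and gives C h^m
  at once; for m = 1 it stops at order 0 and the affine cells step in. The constant is chosen to
  serve both cases.\<close>

lemma spline_partial_error:
  fixes f s :: "'a::euclidean_space \<Rightarrow> real"
  assumes m: "1 \<le> m"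
    and s: "tensor_spline_interpolant m n (uniform_grid n) f s"
    and est: "spline_error_estimate m C (mesh_size n (uniform_grid n)) f s"
    and f: "f differentiable_on unit_cube"
    and b: "b \<in> Basis"
    and L: "L-lipschitz_on unit_cube (partial_deriv unit_cube b f)"
    and x: "x \<in> unit_cube - knot_set n (uniform_grid n)"
    and e: "((\<lambda>t. s (x + t *\<^sub>R b)) has_real_derivative e) (at 0)"
  shows "\<bar>e - partial_deriv unit_cube b f x\<bar> \<le> (L + 2 * \<bar>C\<bar>) * (1 / (real n - 1)) ^ m"
proof -
  have grid: "is_grid n (uniform_grid n)" using s by (simp add: tensor_spline_interpolant_def)
  then have n: "2 \<le> n" by (simp add: is_grid_def)
  define h where "h = 1 / (real n - 1)"
  have h: "0 < h" "mesh_size n (uniform_grid n) = h"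
    using mesh_size_uniform_grid[OF n] n by (auto simp: h_def)
  have est': "\<bar>iterated_partial unit_cube bs (\<lambda>y. f y - s y) y\<bar> < C * h ^ (m + 1 - length bs)"
    if "set bs \<subseteq> Basis" "length bs \<le> m - 1" "y \<in> unit_cube" for bs y
    using est that unfolding spline_error_estimate_def h by blast
  show ?thesis
  proof (cases "m = 1")
    case True
    have "\<bar>e - partial_deriv unit_cube b f x\<bar> \<le> (L + 2 * C) * h"
    proof (rule linear_spline_partial_error[OF grid _ _ f b L _ x e])
      show "\<bar>f y - s y\<bar> \<le> C * h\<^sup>2" if "y \<in> unit_cube" for y
        using est'[of "[]" y] that True by (simp add: iterated_partial_def power2_eq_square)
    qed (use s True mesh_size_uniform_grid[OF n] in \<open>auto simp: tensor_spline_interpolant_def h_def\<close>)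
    also have "\<dots> \<le> (L + 2 * \<bar>C\<bar>) * h"
      using h by (intro mult_right_mono) auto
    finally show ?thesis using True by (simp add: h_def)
  next
    case False
    then have m2: "2 \<le> m" using m by simp
    \<comment> \<open>Here m - 1 is at least 1, so \<open>s\<close> is differentiable. Without this,
      the Frechet derivative in the estimate would be an arbitrary choice, unrelated to
      \<open>e\<close>.\<close>
    have "iterated_partial unit_cube [] s differentiable_on unit_cube"
      using s m2 unfolding tensor_spline_interpolant_def C_k_on_def by auto
    then have "(\<lambda>y. f y - s y) differentiable_on unit_cube"
      using f by (auto simp: iterated_partial_def intro: differentiable_on_diff)
    note fs = partial_deriv_interior[OF this off_knot_set_interior[OF grid x], of b]
    have "((\<lambda>t. f (x + t *\<^sub>R b) - s (x + t *\<^sub>R b)) has_real_derivative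
        (partial_deriv unit_cube b f x - e)) (at 0)"
      using partial_deriv_interior[OF f off_knot_set_interior[OF grid x]] e by (rule DERIV_diff)
    from DERIV_unique[OF this fs]
    have "\<bar>e - partial_deriv unit_cube b f x\<bar> = \<bar>partial_deriv unit_cube b (\<lambda>y. f y - s y) x\<bar>"
      by simp
    also have "\<dots> \<le> C * h ^ m"
    proof -
      have "length [b] \<le> m - 1" using m2 by simp
      then show ?thesis using est'[of "[b]" x] b x by (simp add: iterated_partial_def)
    qed
    also have "\<dots> \<le> (L + 2 * \<bar>C\<bar>) * h ^ m"
      using h lipschitz_on_nonneg[OF L] by (intro mult_right_mono) auto
    finally show ?thesis by (simp add: h_def)
  qed
qed

section \<open>Densities of pushforwards of the uniform distribution\<close>

lemma antiderivative_has_derivative: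
  fixes \<phi> :: "real \<Rightarrow> real"
  assumes "continuous_on UNIV \<phi>" "y \<in> {a<..<c}"
  shows "((\<lambda>y. integral {a..y} \<phi>) has_real_derivative \<phi> y) (at y)"
proof -
  have "((\<lambda>y. integral {a..y} \<phi>) has_real_derivative \<phi> y) (at y within {a..c})"
    using assms by (intro integral_has_real_derivative) (auto intro: continuous_on_subset)
  then show ?thesis using assms(2) by (simp add: at_within_Icc_at)
qed

lemma lipschitz_on_image_subset_interval:
  fixes u :: "'a::metric_space \<Rightarrow> real"
  assumes "compact S" "H-lipschitz_on S u"
  shows "\<exists>R>0. u ` S \<subseteq> {-R<..<R}"
proof -
  have "bounded (u ` S)"
    using assms by (intro compact_imp_bounded compact_continuous_image lipschitz_on_continuous_on)
  then obtain R where R: "0 < R" "\<And>x. x \<in> S \<Longrightarrow> \<bar>u x\<bar> \<le> R"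
    unfolding bounded_pos by auto
  have "u ` S \<subseteq> {-(R + 1)<..<R + 1}"
  proof
    fix y assume "y \<in> u ` S"
    then obtain x where "x \<in> S" "y = u x" by auto
    then show "y \<in> {-(R + 1)<..<R + 1}" using R(2)[of x] by auto
  qed
  then show ?thesis using R(1) by (intro exI[of _ "R + 1"]) auto
qed

context cube_vector_field
begin

text \<open>The primitive of a nonnegative \<open>\<phi>\<close> that starts at -R lies between 0
  and the integral of \<open>\<phi>\<close> over [-R, R]. The bound on test functions is thus a
  constant times a Lebesgue integral, so the law has no mass on null sets.\<close>

lemma pushforward_has_pdf:
  assumes M: "prob_space M" and \<alpha>: "\<And>\<omega>. \<omega> \<in> space M \<Longrightarrow> \<alpha> \<omega> \<in> unit_cube"
    and D: "distributed M lborel \<alpha> (\<lambda>x. ennreal (indicator unit_cube x / measure lborel (unit_cube :: 'a set)))"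
    and s: "H-lipschitz_on unit_cube s"
    and ds: "\<And>x b. x \<in> unit_cube - N \<Longrightarrow> b \<in> Basis \<Longrightarrow>
      ((\<lambda>t. s (x + t *\<^sub>R b)) has_real_derivative e b x) (at 0)"
    and transversal: "\<And>x. x \<in> unit_cube - N \<Longrightarrow> 1 / 2 \<le> (\<Sum>b\<in>Basis. e b x * w b x)"
  shows "\<exists>p. is_pdf M (\<lambda>\<omega>. s (\<alpha> \<omega>)) p"
proof -
  interpret prob_space M by fact
  note cont = lipschitz_on_continuous_on[OF s]
  obtain R where R: "s ` unit_cube \<subseteq> {-R<..<R}"
    using lipschitz_on_image_subset_interval[OF compact_cbox s] by blast
  have rv: "random_variable borel (\<lambda>\<omega>. s (\<alpha> \<omega>))"
    by (rule random_variable_uniform[OF cont \<alpha> D])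
  show ?thesis
  proof (rule is_pdf_exists[OF rv])
    fix A :: "real set" assume A: "A \<in> null_sets lborel"
    show "prob ((\<lambda>\<omega>. s (\<alpha> \<omega>)) -` A \<inter> space M) = 0"
    proof (rule prob_null_of_test_functions[OF rv A])
      fix \<phi> :: "real \<Rightarrow> real"
      assume \<phi>: "continuous_on UNIV \<phi>" "\<And>y. 0 \<le> \<phi> y" "\<And>y. \<phi> y \<le> 1"
      have int: "\<phi> integrable_on {u..v}" for u v
        using \<phi>(1) by (auto intro!: integrable_continuous_interval intro: continuous_on_subset)
      have le: "\<bar>integral {-R..y} \<phi>\<bar> \<le> integral {-R..R} \<phi>" if "y \<in> {-R<..<R}" for y
      proof -
        have "integral {-R..y} \<phi> \<le> integral {-R..R} \<phi>"
          using that \<phi>(2) int by (intro integral_subset_le) auto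
        moreover have "0 \<le> integral {-R..y} \<phi>"
          using \<phi>(2) int by (intro integral_nonneg) auto
        ultimately show ?thesis by simp
      qed
      have "expectation (\<lambda>\<omega>. \<phi> (s (\<alpha> \<omega>))) = integral unit_cube (\<lambda>x. \<phi> (s x))"
        using continuous_on_compose2[OF \<phi>(1) cont] by (intro expectation_uniform[OF _ \<alpha> D]) auto
      also have "\<dots> \<le> 2 * DIM('a) * (integral {-R..R} \<phi> * (L + 2 * B))"
        by (rule integral_test_function_bound[OF s R ds transversal
              antiderivative_has_derivative[OF \<phi>(1)] le \<phi>])
      finally show "expectation (\<lambda>\<omega>. \<phi> (s (\<alpha> \<omega>))) \<le> (2 * DIM('a) * (L + 2 * B)) * integral {-R..R} \<phi>"
        by (simp add: mult_ac)
    qed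
  qed
qed

lemma pushforward_pdf_L1_le:
  assumes M: "prob_space M" and \<alpha>: "\<And>\<omega>. \<omega> \<in> space M \<Longrightarrow> \<alpha> \<omega> \<in> unit_cube"
    and D: "distributed M lborel \<alpha> (\<lambda>x. ennreal (indicator unit_cube x / measure lborel (unit_cube :: 'a set)))"
    and f: "Hf-lipschitz_on unit_cube f" and s: "Hs-lipschitz_on unit_cube s"
    and df: "\<And>x b. x \<in> unit_cube - N \<Longrightarrow> b \<in> Basis \<Longrightarrow>
      ((\<lambda>t. f (x + t *\<^sub>R b)) has_real_derivative g b x) (at 0)"
    and ds: "\<And>x b. x \<in> unit_cube - N \<Longrightarrow> b \<in> Basis \<Longrightarrow>
      ((\<lambda>t. s (x + t *\<^sub>R b)) has_real_derivative e b x) (at 0)"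
    and unit: "\<And>x. x \<in> unit_cube \<Longrightarrow> (\<Sum>b\<in>Basis. g b x * w b x) = 1"
    and \<delta>: "\<And>x b. x \<in> unit_cube - N \<Longrightarrow> b \<in> Basis \<Longrightarrow> \<bar>e b x - g b x\<bar> \<le> \<delta>" "0 \<le> \<delta>"
    and \<eta>: "\<And>x. x \<in> unit_cube \<Longrightarrow> \<bar>f x - s x\<bar> \<le> \<eta>"
    and p: "is_pdf M (\<lambda>\<omega>. f (\<alpha> \<omega>)) p" and q: "is_pdf M (\<lambda>\<omega>. s (\<alpha> \<omega>)) q"
  shows "(LINT y|lborel. \<bar>p y - q y\<bar>) \<le> 2 * (DIM('a) * (\<eta> * (L + 2 * B) + \<delta> * B))"
proof -
  interpret prob_space M by fact
  let ?K = "DIM('a) * (\<eta> * (L + 2 * B) + \<delta> * B)"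
  note contf = lipschitz_on_continuous_on[OF f] and conts = lipschitz_on_continuous_on[OF s]
  obtain Rf Rs where R: "f ` unit_cube \<subseteq> {-Rf<..<Rf}" "s ` unit_cube \<subseteq> {-Rs<..<Rs}"
    using lipschitz_on_image_subset_interval[OF compact_cbox f]
      lipschitz_on_image_subset_interval[OF compact_cbox s] by blast
  \<comment> \<open>An interval around both ranges lets one primitive serve \<open>f\<close> and
    \<open>s\<close>.\<close>
  define R where "R = max Rf Rs"
  have Rf: "f ` unit_cube \<subseteq> {-R<..<R}" and Rs: "s ` unit_cube \<subseteq> {-R<..<R}"
    using R unfolding R_def by fastforce+
  have rvf: "random_variable borel (\<lambda>\<omega>. f (\<alpha> \<omega>))" and rvs: "random_variable borel (\<lambda>\<omega>. s (\<alpha> \<omega>))"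
    using random_variable_uniform[OF contf \<alpha> D] random_variable_uniform[OF conts \<alpha> D] by auto
  have "0 \<le> \<eta>" using \<eta>[of 0] by (force simp: mem_box)
  then have K: "0 \<le> ?K" using B_nonneg L_nonneg \<delta>(2) by auto
  have test: "\<bar>expectation (\<lambda>\<omega>. \<phi> (f (\<alpha> \<omega>))) - expectation (\<lambda>\<omega>. \<phi> (s (\<alpha> \<omega>)))\<bar> \<le> ?K"
    if \<phi>: "continuous_on UNIV \<phi>" "\<And>y. 0 \<le> \<phi> y" "\<And>y. \<phi> y \<le> (1::real)" for \<phi>
  proof -
    have \<phi>1: "\<bar>\<phi> y\<bar> \<le> 1" for y using \<phi>(2,3)[of y] by simp
    have "expectation (\<lambda>\<omega>. \<phi> (f (\<alpha> \<omega>))) = integral unit_cube (\<lambda>x. \<phi> (f x))"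
      "expectation (\<lambda>\<omega>. \<phi> (s (\<alpha> \<omega>))) = integral unit_cube (\<lambda>x. \<phi> (s x))"
      using continuous_on_compose2[OF \<phi>(1) contf] continuous_on_compose2[OF \<phi>(1) conts]
      by (auto intro!: expectation_uniform[OF _ \<alpha> D])
    then show ?thesis
      using integral_test_function_diff[OF f Rf s Rs df ds unit \<delta>(1) \<eta>
          antiderivative_has_derivative[OF \<phi>(1)] \<phi>(1) \<phi>1] by simp
  qed
  show ?thesis
  proof (rule is_pdf_L1_le[OF p q])
    fix A :: "real set" assume A: "A \<in> sets borel"
    show "prob ((\<lambda>\<omega>. f (\<alpha> \<omega>)) -` A \<inter> space M) \<le> prob ((\<lambda>\<omega>. s (\<alpha> \<omega>)) -` A \<inter> space M) + ?K"
    proof (rule prob_le_of_test_functions[OF rvf rvs A _ K])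
      fix \<phi> :: "real \<Rightarrow> real"
      assume "continuous_on UNIV \<phi>" "\<And>y. 0 \<le> \<phi> y" "\<And>y. \<phi> y \<le> 1"
      from test[OF this]
      show "expectation (\<lambda>\<omega>. \<phi> (f (\<alpha> \<omega>))) \<le> expectation (\<lambda>\<omega>. \<phi> (s (\<alpha> \<omega>))) + ?K" by linarith
    qed
    show "prob ((\<lambda>\<omega>. s (\<alpha> \<omega>)) -` A \<inter> space M) \<le> prob ((\<lambda>\<omega>. f (\<alpha> \<omega>)) -` A \<inter> space M) + ?K"
    proof (rule prob_le_of_test_functions[OF rvs rvf A _ K])
      fix \<phi> :: "real \<Rightarrow> real"
      assume "continuous_on UNIV \<phi>" "\<And>y. 0 \<le> \<phi> y" "\<And>y. \<phi> y \<le> 1"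
      from test[OF this]
      show "expectation (\<lambda>\<omega>. \<phi> (s (\<alpha> \<omega>))) \<le> expectation (\<lambda>\<omega>. \<phi> (f (\<alpha> \<omega>))) + ?K" by linarith
    qed
  qed
qed

end

section \<open>The normalized gradient field and the convergence rate\<close>

lemma power2_norm_gradient:
  "(norm (gradient S f x))\<^sup>2 = (\<Sum>b\<in>Basis. (partial_deriv S b f x)\<^sup>2)"
  unfolding power2_norm_eq_inner
  by (subst euclidean_inner) (simp add: gradient_def power2_eq_square)

text \<open>The order of quantifiers is the point: \<open>w\<close>, \<open>L\<close> and
  \<open>B\<close> come from \<open>f\<close> alone and work for every grid. \<open>w\<close> is
  Lipschitz because the partials of a C^2 function are, and the squared gradient norm is bounded
  away from 0.\<close>

lemma normalized_gradient_field:
  fixes f :: "'a::euclidean_space \<Rightarrow> real"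
  assumes f: "C_k_on k unit_cube f" "2 \<le> k"
    and grad: "(INF x\<in>unit_cube. norm (gradient unit_cube f x)) > 0"
  obtains w L B where
    "\<forall>x\<in>unit_cube. (\<Sum>b\<in>Basis. partial_deriv unit_cube b f x * w b x) = 1"
    "\<forall>n \<alpha>. is_grid n \<alpha> \<longrightarrow> cube_vector_field (knot_set n \<alpha>) w L B"
proof -
  note f = C_k_on_partials[OF f]
  let ?g = "\<lambda>b. partial_deriv unit_cube b f"
  define G where "G x = (\<Sum>b\<in>Basis. ?g b x * ?g b x)" for x
  define w where "w b x = ?g b x * inverse (G x)" for b x
  define c where "c = (INF x\<in>unit_cube. norm (gradient unit_cube f x))"
  have c: "0 < c" using grad by (simp add: c_def)
  have G: "c\<^sup>2 \<le> G x" if "x \<in> unit_cube" for x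
  proof -
    have "c \<le> norm (gradient unit_cube f x)"
      unfolding c_def by (rule cINF_lower[OF bdd_belowI[of _ 0] that]) auto
    then have "c\<^sup>2 \<le> (norm (gradient unit_cube f x))\<^sup>2" using c by (intro power_mono) auto
    then show ?thesis
      unfolding power2_norm_gradient by (simp add: G_def power2_eq_square)
  qed
  have lip_g: "\<exists>H. H-lipschitz_on unit_cube (?g b)" if "b \<in> Basis" for b
    using f(3,4) that by (intro ex_lipschitz_of_partials) auto
  have "\<exists>H. H-lipschitz_on unit_cube G"
    unfolding G_def by (intro ex_lipschitz_sum ex_lipschitz_mult lip_g compact_cbox)
  then have "\<exists>H. H-lipschitz_on unit_cube (\<lambda>x. inverse (G x))"
    by (rule ex_lipschitz_inverse[where c = "c\<^sup>2"]) (use c G in auto)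
  then have "\<exists>H. H-lipschitz_on unit_cube (w b)" if "b \<in> Basis" for b
    unfolding w_def using that by (intro ex_lipschitz_mult lip_g compact_cbox)
  then obtain L where L: "\<And>b. b \<in> Basis \<Longrightarrow> L-lipschitz_on unit_cube (w b)"
    using ex_uniform_lipschitz[of Basis "\<lambda>_. unit_cube" w] by auto
  have "bounded (\<Union>b\<in>Basis. w b ` unit_cube)"
    by (intro bounded_UN ballI finite_Basis compact_imp_bounded compact_continuous_image
        compact_cbox lipschitz_on_continuous_on[OF L])
  then obtain B where B: "\<And>x b. x \<in> unit_cube \<Longrightarrow> b \<in> Basis \<Longrightarrow> \<bar>w b x\<bar> \<le> B"
    unfolding bounded_iff by auto
  show thesis
  proof (rule that; intro ballI allI impI)
    fix x :: 'a assume "x \<in> unit_cube"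
    then have "0 < G x" using G c by (meson less_le_trans zero_less_power)
    moreover have "(\<Sum>b\<in>Basis. ?g b x * w b x) = G x * inverse (G x)"
      by (simp add: w_def G_def sum_distrib_right mult.assoc)
    ultimately show "(\<Sum>b\<in>Basis. ?g b x * w b x) = 1" by simp
  next
    fix n \<alpha> assume "is_grid n \<alpha>"
    then show "cube_vector_field (knot_set n \<alpha> :: 'a set) w L B"
      by unfold_locales (auto intro: negligible_knot_set off_knot_set L B)
  qed
qed

theorem corollary5p4:
  fixes f :: "'a::euclidean_space \<Rightarrow> real"
    and s :: "nat \<Rightarrow> 'a \<Rightarrow> real"
    and m :: nat
    and C :: real
    and M :: "'w measure"
    and \<alpha> :: "'w \<Rightarrow> 'a"
  assumes "1 \<le> m"
    and "C_k_on (m + 1) unit_cube f"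
    and "(INF x\<in>unit_cube. norm (gradient unit_cube f x)) > 0"
    and "\<forall>\<^sub>F n in sequentially.
           tensor_spline_interpolant m n (uniform_grid n) f (s n) \<and>
           spline_error_estimate m C (mesh_size n (uniform_grid n)) f (s n)"
    and "prob_space M"
    and "\<forall>\<omega>\<in>space M. \<alpha> \<omega> \<in> unit_cube"
    and "distributed M lborel \<alpha> (\<lambda>x. ennreal (indicator unit_cube x / measure lborel (unit_cube :: 'a set)))"
  shows "(\<exists>p. is_pdf M (\<lambda>\<omega>. f (\<alpha> \<omega>)) p) \<and>
    (\<exists>K>0. \<exists>N\<^sub>0. \<forall>n N. N = n ^ DIM('a) \<and> N \<ge> N\<^sub>0 \<longrightarrow>
       (\<exists>p. is_pdf M (\<lambda>\<omega>. s n (\<alpha> \<omega>)) p) \<and>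
       (\<forall>p_f p_s. is_pdf M (\<lambda>\<omega>. f (\<alpha> \<omega>)) p_f \<and> is_pdf M (\<lambda>\<omega>. s n (\<alpha> \<omega>)) p_s \<longrightarrow>
          (LINT y|lborel. \<bar>p_f y - p_s y\<bar>) \<le> K * real N powr (- (real m / real DIM('a)))))"
proof -
  have k2: "2 \<le> m + 1" using assms(1) by simp
  have \<alpha>: "\<And>\<omega>. \<omega> \<in> space M \<Longrightarrow> \<alpha> \<omega> \<in> unit_cube" using assms(6) by blast
  note M = assms(5) and D = assms(7)
  note f = C_k_on_partials[OF assms(2) k2]
  let ?g = "\<lambda>b. partial_deriv unit_cube b f"
  obtain w L B where "\<forall>x\<in>unit_cube. (\<Sum>b\<in>Basis. ?g b x * w b x) = 1"
    and "\<forall>n \<beta>. is_grid n \<beta> \<longrightarrow> cube_vector_field (knot_set n \<beta>) w L B"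
    using normalized_gradient_field[OF assms(2) k2 assms(3)] .
  then have unit: "\<And>x. x \<in> unit_cube \<Longrightarrow> (\<Sum>b\<in>Basis. ?g b x * w b x) = 1"
    and field: "\<And>n \<beta>. is_grid n \<beta> \<Longrightarrow> cube_vector_field (knot_set n \<beta>) w L B"
    by blast+
  obtain Hf where Hf: "Hf-lipschitz_on unit_cube f"
    using ex_lipschitz_of_partials[OF convex_box(1) compact_cbox f(1,2)] by blast
  have "\<exists>H. H-lipschitz_on unit_cube (?g b)" if "b \<in> Basis" for b
    using f(3,4) that by (intro ex_lipschitz_of_partials) auto
  then obtain Lg where Lg: "0 \<le> Lg" "\<And>b. b \<in> Basis \<Longrightarrow> Lg-lipschitz_on unit_cube (?g b)"
    using ex_uniform_lipschitz[of Basis "\<lambda>_. unit_cube" ?g] by auto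
  \<comment> \<open>For \<open>f\<close> alone, the two-point grid is enough: its knot hyperplanes
    are those of the faces of the cube.\<close>
  have grid2: "is_grid 2 (uniform_grid 2)" by (simp add: is_grid_def uniform_grid_def)
  have df: "((\<lambda>t. f (x + t *\<^sub>R b)) has_real_derivative ?g b x) (at 0)"
    if "is_grid n \<beta>" "x \<in> unit_cube - knot_set n \<beta>" "b \<in> Basis" for n \<beta> x b
    using partial_deriv_interior[OF f(1) off_knot_set_interior[OF that(1,2)]] .
  interpret F: cube_vector_field "knot_set 2 (uniform_grid 2)" w L B
    using field[OF grid2] .
  define d where "d = real DIM('a)"
  define K1 where "K1 = Lg + 2 * \<bar>C\<bar>"
  have d: "0 < d" and K1: "0 \<le> K1" using Lg(1) by (auto simp: d_def K1_def)
  \<comment> \<open>The leading 2 comes from \<open>is_pdf_L1_le\<close>, the factor 2^m from 1/(n -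
    1) being at most 2/n, and the final 1 makes \<open>K\<close> positive.\<close>
  define K where "K = 2 * (d * (\<bar>C\<bar> * (L + 2 * B) + K1 * B)) * 2 ^ m + 1"
  have K: "0 < K"
    unfolding K_def using d K1 F.B_nonneg F.L_nonneg by (intro add_nonneg_pos mult_nonneg_nonneg add_nonneg_nonneg) auto
  obtain n1 where n1: "\<And>n. n1 \<le> n \<Longrightarrow> tensor_spline_interpolant m n (uniform_grid n) f (s n) \<and>
      spline_error_estimate m C (mesh_size n (uniform_grid n)) f (s n)"
    using assms(4) unfolding eventually_sequentially by blast
  \<comment> \<open>Chosen so that 2 d K1 B h is at most 1 with h = 1/(n - 1). The gradient error
    then changes the pairing with the field by at most 1/2.\<close>
  obtain n2 :: nat where n2: "2 * d * K1 * B + 2 \<le> real n2" using real_arch_simple by blast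
  define n0 where "n0 = max n1 n2"
  have main: "(\<exists>p. is_pdf M (\<lambda>\<omega>. s n (\<alpha> \<omega>)) p) \<and>
       (\<forall>p_f p_s. is_pdf M (\<lambda>\<omega>. f (\<alpha> \<omega>)) p_f \<and> is_pdf M (\<lambda>\<omega>. s n (\<alpha> \<omega>)) p_s \<longrightarrow>
          (LINT y|lborel. \<bar>p_f y - p_s y\<bar>) \<le> K * real n powr (- real m))"
    if n: "n0 \<le> n" for n
  proof -
    have s: "tensor_spline_interpolant m n (uniform_grid n) f (s n)"
      and est: "spline_error_estimate m C (mesh_size n (uniform_grid n)) f (s n)"
      using n1[of n] n by (auto simp: n0_def)
    have grid: "is_grid n (uniform_grid n)" and tps: "tensor_product_spline m n (uniform_grid n) (s n)"
      using s by (auto simp: tensor_spline_interpolant_def)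
    have n2': "2 \<le> n" using grid by (simp add: is_grid_def)
    interpret S: cube_vector_field "knot_set n (uniform_grid n)" w L B
      using field[OF grid] .
    define h where "h = 1 / (real n - 1)"
    have h: "0 < h" "h \<le> 1" "h \<le> 2 / real n" using n2' by (auto simp: h_def field_simps)
    have hm: "h ^ m \<le> h ^ 1" by (rule power_decreasing[OF assms(1) less_imp_le[OF h(1)] h(2)])
    obtain Hs where Hs: "Hs-lipschitz_on unit_cube (s n)"
      using tensor_product_spline_lipschitz[OF grid tps] by blast
    \<comment> \<open>The partial derivatives of the spline off the knots; on the knot hyperplanes
      the values may be arbitrary.\<close>
    define e where "e b x = (SOME d. ((\<lambda>t. s n (x + t *\<^sub>R b)) has_real_derivative d) (at 0))" for b x
    have e: "((\<lambda>t. s n (x + t *\<^sub>R b)) has_real_derivative e b x) (at 0)"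
      if "x \<in> unit_cube - knot_set n (uniform_grid n)" "b \<in> Basis" for x b
      unfolding e_def by (rule someI_ex) (rule tensor_product_spline_has_partial[OF grid tps that(1)])
    have err: "\<bar>e b x - ?g b x\<bar> \<le> K1 * h ^ m"
      if "x \<in> unit_cube - knot_set n (uniform_grid n)" "b \<in> Basis" for x b
      using spline_partial_error[OF assms(1) s est f(1) that(2) Lg(2)[OF that(2)] that(1) e[OF that]]
      by (simp add: K1_def h_def)
    \<comment> \<open>One power of h is given away: the rate is set by the gradient error, which is
      of order h^m.\<close>
    have \<eta>: "\<bar>f x - s n x\<bar> \<le> \<bar>C\<bar> * h ^ m" if "x \<in> unit_cube" for x
    proof -
      have "\<bar>f x - s n x\<bar> \<le> C * h ^ (m + 1)"
        using est[unfolded spline_error_estimate_def, rule_format, of "[]" x] that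
          mesh_size_uniform_grid(1)[OF n2'] by (simp add: iterated_partial_def h_def)
      also have "\<dots> \<le> \<bar>C\<bar> * h ^ (m + 1)"
        using h(1) by (intro mult_right_mono) simp_all
      also have "\<dots> \<le> \<bar>C\<bar> * h ^ m"
        using h(1,2) by (intro mult_left_mono power_decreasing) simp_all
      finally show ?thesis .
    qed
    have small: "d * (K1 * h ^ m * B) \<le> 1 / 2"
    proof -
      have "2 * d * K1 * B + 2 \<le> real n" using n n2 by (simp add: n0_def)
      then have "2 * d * K1 * B * h \<le> 1" using n2' by (simp add: h_def field_simps)
      moreover have "d * K1 * B * h ^ m \<le> d * K1 * B * h"
        using hm d K1 F.B_nonneg by (intro mult_left_mono) auto
      ultimately show ?thesis by (simp add: mult_ac)
    qed
    have transversal: "1 / 2 \<le> (\<Sum>b\<in>Basis. e b x * w b x)"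
      if x: "x \<in> unit_cube - knot_set n (uniform_grid n)" for x
    proof -
      have "(\<Sum>b\<in>Basis. e b x * w b x) = 1 + (\<Sum>b\<in>Basis. (e b x - ?g b x) * w b x)"
        using unit[of x] x by (simp add: left_diff_distrib sum_subtractf)
      moreover have "\<bar>\<Sum>b\<in>Basis. (e b x - ?g b x) * w b x\<bar> \<le> (\<Sum>b\<in>(Basis::'a set). K1 * h ^ m * B)"
        using err[OF x] S.bound_w[of x] x K1 h
        by (intro order_trans[OF sum_abs] sum_mono) (auto simp: abs_mult intro!: mult_mono)
      ultimately show ?thesis using small by (simp add: d_def)
    qed
    have "\<exists>p. is_pdf M (\<lambda>\<omega>. s n (\<alpha> \<omega>)) p"
      by (rule S.pushforward_has_pdf[OF M \<alpha> D Hs e transversal])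
    moreover have "(LINT y|lborel. \<bar>p y - q y\<bar>) \<le> K * real n powr (- real m)"
      if pq: "is_pdf M (\<lambda>\<omega>. f (\<alpha> \<omega>)) p" "is_pdf M (\<lambda>\<omega>. s n (\<alpha> \<omega>)) q" for p q
    proof -
      have "0 \<le> K1 * h ^ m" using K1 h by simp
      from S.pushforward_pdf_L1_le[OF M \<alpha> D Hf Hs df[OF grid] e unit err this \<eta> pq]
      have "(LINT y|lborel. \<bar>p y - q y\<bar>) \<le> 2 * (d * (\<bar>C\<bar> * (L + 2 * B) + K1 * B)) * h ^ m"
        by (simp add: d_def algebra_simps)
      also have "\<dots> \<le> 2 * (d * (\<bar>C\<bar> * (L + 2 * B) + K1 * B)) * (2 / real n) ^ m"
        using h d K1 F.B_nonneg F.L_nonneg by (intro mult_left_mono power_mono) auto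
      also have "\<dots> = (K - 1) * (1 / real n ^ m)"
        by (simp add: K_def power_divide)
      also have "\<dots> \<le> K * (1 / real n ^ m)"
        by (intro mult_right_mono) auto
      also have "1 / real n ^ m = real n powr (- real m)"
        using n2' by (simp add: powr_minus powr_realpow divide_inverse)
      finally show ?thesis .
    qed
    ultimately show ?thesis by blast
  qed
  \<comment> \<open>With \<open>f\<close> in place of the spline the pairing with the field equals
    1, so transversality is immediate.\<close>
  have "\<exists>p. is_pdf M (\<lambda>\<omega>. f (\<alpha> \<omega>)) p"
    by (rule F.pushforward_has_pdf[OF M \<alpha> D Hf df[OF grid2]]) (simp_all add: unit)
  moreover have "(\<exists>p. is_pdf M (\<lambda>\<omega>. s n (\<alpha> \<omega>)) p) \<and>
       (\<forall>p_f p_s. is_pdf M (\<lambda>\<omega>. f (\<alpha> \<omega>)) p_f \<and> is_pdf M (\<lambda>\<omega>. s n (\<alpha> \<omega>)) p_s \<longrightarrow>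
          (LINT y|lborel. \<bar>p_f y - p_s y\<bar>) \<le> K * real N powr (- (real m / real DIM('a))))"
    if N: "N = n ^ DIM('a)" "n0 ^ DIM('a) \<le> N" for n N
  proof -
    have "n0 \<le> n" using N by (simp add: power_mono_iff)
    moreover have "real N powr (- (real m / real DIM('a))) = real n powr (- real m)"
    \<comment> \<open>\<open>powr\<close> with base 0 has the value 0, so both sides agree for n = 0
      as well.\<close>
    proof (cases "n = 0")
      case False
      then have "real N = real n powr real DIM('a)" using N(1) by (simp add: powr_realpow)
      then show ?thesis by (simp add: powr_powr)
    qed (use N(1) in simp)
    ultimately show ?thesis using main by simp
  qed
  ultimately show ?thesis using K by (intro conjI exI[of _ K] exI[of _ "n0 ^ DIM('a)"]) auto
qed

end
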